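(* Let $E$ be a complex Banach lattice and let $T \in \mathcal{L}(E)$ be uniformly eventually positive. Assume that the spectral radius $r(T)$ is a Riesz point of $T$ and that the corresponding pole order of the resolvent is $1$. Then \[ \dim \ker(\lambda I - T) \le \dim \ker(r(T) I - T) \] for every complex number $\lambda$ with $|\lambda| = r(T)$.
   Context: A bounded linear operator $T$ on a complex Banach lattice $E$ is called uniformly eventually positive if there exists $n_0 \in \mathbb{N}_0$ such that $T^n$ is a positive operator for each $n \ge n_0$. A spectral value $\mu$ of $T$ is a Riesz point of $T$ if it is a pole of the resolvent $R(\cdot,T)$ and the corresponding spectral space (range of the spectral projection associated with $\mu$) is finite-dimensional. $r(T)$ denotes the spectral radius. *)

theory Defs
  imports "HOL-Analysis.Analysis"
begin

class banach_lattice = ordered_real_vector + lattice + banach +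
  assumes lattice_norm: "sup x (- x) \<le> sup y (- y) \<Longrightarrow> norm x \<le> norm y"

text \<open>A complex Banach lattice E is the complexification E_R + i E_R of a real Banach
lattice E_R.  We represent the element x + i y of E by the pair (x, y).\<close>

type_synonym 'r cvec = "'r \<times> 'r"
type_synonym 'r cop = "'r cvec \<Rightarrow> 'r cvec"

definition cscale :: "complex \<Rightarrow> 'r::banach_lattice cvec \<Rightarrow> 'r cvec" where
  "cscale c z = (Re c *\<^sub>R fst z - Im c *\<^sub>R snd z, Re c *\<^sub>R snd z + Im c *\<^sub>R fst z)"

text \<open>Modulus |x + i y| = sup over t of (cos t x + sin t y), which exists in a Banach lattice.\<close>

definition cabs :: "'r::banach_lattice cvec \<Rightarrow> 'r" where
  "cabs z = (THE m. (\<forall>t. cos t *\<^sub>R fst z + sin t *\<^sub>R snd z \<le> m) \<and>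
       (\<forall>u. (\<forall>t. cos t *\<^sub>R fst z + sin t *\<^sub>R snd z \<le> u) \<longrightarrow> m \<le> u))"

definition cnorm :: "'r::banach_lattice cvec \<Rightarrow> real" where
  "cnorm z = norm (cabs z)"

definition cpos :: "'r::banach_lattice cvec set" where
  "cpos = {(x, 0) | x. 0 \<le> x}"

definition bounded_cop :: "'r::banach_lattice cop \<Rightarrow> bool" where
  "bounded_cop T \<longleftrightarrow> (\<forall>z w. T (z + w) = T z + T w) \<and> (\<forall>c z. T (cscale c z) = cscale c (T z))
     \<and> (\<exists>K. \<forall>z. cnorm (T z) \<le> K * cnorm z)"

definition opnorm :: "'r::banach_lattice cop \<Rightarrow> real" where
  "opnorm S = Sup {cnorm (S z) | z. cnorm z \<le> 1}"

definition positive_cop :: "'r::banach_lattice cop \<Rightarrow> bool" where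
  "positive_cop T \<longleftrightarrow> T ` cpos \<subseteq> cpos"

definition unif_ev_pos :: "'r::banach_lattice cop \<Rightarrow> bool" where
  "unif_ev_pos T \<longleftrightarrow> (\<exists>n0::nat. \<forall>n\<ge>n0. positive_cop (T ^^ n))"

definition resolvent_set :: "'r::banach_lattice cop \<Rightarrow> complex set" where
  "resolvent_set T = {l. \<exists>S. bounded_cop S \<and> (\<forall>z. S (cscale l z - T z) = z)
                        \<and> (\<forall>z. cscale l (S z) - T (S z) = z)}"

definition cspec :: "'r::banach_lattice cop \<Rightarrow> complex set" where
  "cspec T = - resolvent_set T"

definition resolv :: "'r::banach_lattice cop \<Rightarrow> complex \<Rightarrow> 'r cop" where
  "resolv T l = inv (\<lambda>z. cscale l z - T z)"

definition spr :: "'r::banach_lattice cop \<Rightarrow> real" where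
  "spr T = Sup (cmod ` cspec T)"

definition op_holomorphic_on :: "(complex \<Rightarrow> 'r::banach_lattice cop) \<Rightarrow> complex set \<Rightarrow> bool" where
  "op_holomorphic_on g S \<longleftrightarrow> (\<forall>a\<in>S. \<exists>D. bounded_cop D \<and>
     ((\<lambda>w. opnorm (\<lambda>z. cscale (1 / (w - a)) (g w z - g a z) - D z)) \<longlongrightarrow> 0) (at a within S))"

definition resolvent_pole_order :: "'r::banach_lattice cop \<Rightarrow> complex \<Rightarrow> nat \<Rightarrow> bool" where
  "resolvent_pole_order T \<mu> k \<longleftrightarrow> k \<ge> 1 \<and> \<mu> \<in> cspec T \<and>
     (\<exists>e>0. \<exists>g. (\<forall>l\<in>ball \<mu> e. bounded_cop (g l)) \<and> op_holomorphic_on g (ball \<mu> e) \<and>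
        (\<exists>z. g \<mu> z \<noteq> 0) \<and>
        (\<forall>l\<in>ball \<mu> e - {\<mu>}. l \<notin> cspec T \<and>
            resolv T l = (\<lambda>z. cscale (1 / (l - \<mu>) ^ k) (g l z))))"

definition resolvent_pole :: "'r::banach_lattice cop \<Rightarrow> complex \<Rightarrow> bool" where
  "resolvent_pole T \<mu> \<longleftrightarrow> (\<exists>k. resolvent_pole_order T \<mu> k)"

text \<open>Riesz projection (1/(2 pi i)) times the contour integral of R(lambda,T) over the circle
of radius delta about mu, evaluated pointwise:
lambda = mu + delta e^{it}, d lambda = i delta e^{it} dt.\<close>

definition riesz_proj :: "'r::banach_lattice cop \<Rightarrow> complex \<Rightarrow> real \<Rightarrow> 'r cop" where
  "riesz_proj T \<mu> \<delta> z = integral {0..2*pi}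
      (\<lambda>t. cscale (complex_of_real \<delta> * cis t / complex_of_real (2*pi)) (resolv T (\<mu> + complex_of_real \<delta> * cis t) z))"

definition admissible_radius :: "'r::banach_lattice cop \<Rightarrow> complex \<Rightarrow> real \<Rightarrow> bool" where
  "admissible_radius T \<mu> \<delta> \<longleftrightarrow> \<delta> > 0 \<and> (\<forall>l. 0 < cmod (l - \<mu>) \<and> cmod (l - \<mu>) \<le> \<delta> \<longrightarrow> l \<notin> cspec T)"

definition spectral_projection :: "'r::banach_lattice cop \<Rightarrow> complex \<Rightarrow> 'r cop" where
  "spectral_projection T \<mu> = riesz_proj T \<mu> (SOME \<delta>. admissible_radius T \<mu> \<delta>)"

definition spectral_space :: "'r::banach_lattice cop \<Rightarrow> complex \<Rightarrow> 'r cvec set" where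
  "spectral_space T \<mu> = range (spectral_projection T \<mu>)"

definition cdim :: "'r::banach_lattice cvec set \<Rightarrow> enat" where
  "cdim V = (if \<exists>B. finite B \<and> B \<subseteq> V \<and> \<not> module.dependent cscale B \<and> V \<subseteq> module.span cscale B
             then enat (vector_space.dim cscale V) else \<infinity>)"

definition riesz_point :: "'r::banach_lattice cop \<Rightarrow> complex \<Rightarrow> bool" where
  "riesz_point T \<mu> \<longleftrightarrow> \<mu> \<in> cspec T \<and> resolvent_pole T \<mu> \<and> cdim (spectral_space T \<mu>) \<noteq> \<infinity>"

definition ckernel :: "'r::banach_lattice cop \<Rightarrow> complex \<Rightarrow> 'r cvec set" where
  "ckernel T l = {z. cscale l z - T z = 0}"

end

theory Submission
  imports Defs "HOL-Library.Lattice_Algebras"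
begin

text \<open>Let \<open>r\<close> be the spectral radius; only \<open>r > 0\<close> and \<open>dim ker(r - T) < \<infinity>\<close> need work.  The pole
  being simple, \<open>P = lim (l - r) R(l,T)\<close> as \<open>l\<close> decreases to \<open>r\<close> is a projection onto
  \<open>ker(r - T)\<close>.  Eventual positivity makes \<open>P\<close> positive, and \<open>r^n |z| \<le> T^n |z|\<close> for large \<open>n\<close>
  yields \<open>|z| \<le> P|z|\<close> for every \<open>z \<in> ker(\<mu> - T)\<close> with \<open>|\<mu>| = r\<close>.

  Modulo the null ideal of \<open>P\<close>, the range of \<open>P\<close> is a finite-dimensional vector lattice, spanned
  by a maximal family of disjoint positive vectors \<open>e\<close> (atoms).  At each atom the modulus of every
  \<open>z \<in> ker(\<mu> - T)\<close> is a scalar multiple of \<open>e\<close>; this forces \<open>ker(\<mu> - T)\<close> to be at most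
  one-dimensional at each atom, so its dimension does not exceed the number of atoms, which is at
  most \<open>dim ker(r - T)\<close>.\<close>

text \<open>Eventual positivity makes neither \<open>T\<close> nor its resolvent positive; what can
  be controlled is \<open>T ^^ n0\<close> applied after powers of the resolvent. That suffices,
  because \<open>T ^^ n0\<close> acts on the range of P as multiplication by r^n0, which can be
  cancelled in the limit. An atom of the range of P is in general not an atom of E. For integration
  over the circle, viewed as a projection onto the constants, the constant 1 is an atom, and the
  vectors z to be counted are functions of constant modulus. A linear space of such functions is at
  most one-dimensional: a combination that vanishes at one point vanishes everywhere. The abstract
  proof has no points, so it works with the ideals \<open>null e\<close> and replaces a point by
  finite grids of values. The atoms come from counting: disjoint fixed vectors are linearly
  independent, so a system of largest size exists, and a member that could be split would be
  replaced by two.\<close>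

instance banach_lattice \<subseteq> lattice_ab_group_add ..

section \<open>Vector lattices\<close>

text \<open>Distributivity comes from the group structure: \<open>x - inf x c\<close> is the
  positive part of x - c, hence increasing in x. So \<open>w + (s - inf s c)\<close> is an upper
  bound of \<open>a\<close> and \<open>b\<close>, hence of \<open>s\<close>.\<close>

lemma inf_sup_le_sup_inf:
  fixes a b c :: "'a::lattice_ab_group_add"
  shows "inf (sup a b) c \<le> sup (inf a c) (inf b c)"
proof -
  define s w where "s = sup a b" and "w = sup (inf a c) (inf b c)"
  have *: "x \<le> w + (s - inf s c)" if "x \<le> s" "inf x c \<le> w" for x
  proof -
    have "x - inf x c = sup 0 (x - c)" "s - inf s c = sup 0 (s - c)"
      by (simp_all add: diff_inf_eq_sup add_sup_distrib_left)
    moreover have "sup 0 (x - c) \<le> sup 0 (s - c)"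
      using that(1) by (intro sup_mono) auto
    ultimately have "x - inf x c \<le> s - inf s c" by simp
    then have "x \<le> inf x c + (s - inf s c)" by (metis diff_le_eq add.commute)
    also have "\<dots> \<le> w + (s - inf s c)" using that(2) by simp
    finally show ?thesis .
  qed
  have "s \<le> w + (s - inf s c)"
    unfolding s_def
    by (rule sup_least; fold s_def; rule *) (auto simp: s_def w_def)
  then have "inf s c \<le> w" by (metis add_diff_eq add.commute add_le_cancel_left le_diff_eq)
  then show ?thesis by (simp add: s_def w_def)
qed

text \<open>The right-hand side expands to the infimum of a + b, a + c, c + b and c + c; by
  positivity the last three dominate \<open>c\<close>.\<close>

lemma inf_add_le:
  fixes a b c :: "'a::lattice_ab_group_add"
  assumes "0 \<le> a" "0 \<le> b" "0 \<le> c"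
  shows "inf (a + b) c \<le> inf a c + inf b c"
proof -
  have "inf a c + inf b c = inf (inf (a + b) (a + c)) (inf (c + b) (c + c))"
    by (simp add: add_inf_distrib_left add_inf_distrib_right inf.assoc inf.left_commute)
  moreover have "inf (a + b) c \<le> x" if "c \<le> x" for x using that by (simp add: le_infI2)
  ultimately show ?thesis using assms by (simp add: le_infI2 add_increasing add_increasing2)
qed

definition modulus :: "'a::banach_lattice \<Rightarrow> 'a" where
  "modulus x = sup x (- x)"

lemma le_modulus: "x \<le> modulus x" "- x \<le> modulus x"
  by (simp_all add: modulus_def)

lemma modulus_leI: "x \<le> u \<Longrightarrow> - x \<le> u \<Longrightarrow> modulus x \<le> u"
  by (simp add: modulus_def)

lemma modulus_nonneg [simp]: "0 \<le> modulus x"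
proof -
  have "0 \<le> modulus x + modulus x"
    using add_mono[OF le_modulus[of x]] by simp
  then show ?thesis by simp
qed

lemma modulus_pos [simp]: "0 \<le> x \<Longrightarrow> modulus x = x"
  by (intro antisym modulus_leI le_modulus) (auto intro: order_trans[of _ 0])

lemma modulus_minus [simp]: "modulus (- x) = modulus x"
  by (simp add: modulus_def sup.commute)

lemma modulus_triangle: "modulus (x + y) \<le> modulus x + modulus y"
  using add_mono[OF le_modulus(1)[of x] le_modulus(1)[of y]]
    add_mono[OF le_modulus(2)[of x] le_modulus(2)[of y]]
  by (intro modulus_leI) auto

lemma modulus_scaleR_le: "modulus (c *\<^sub>R x) \<le> \<bar>c\<bar> *\<^sub>R modulus x"
proof (cases "0 \<le> c")
  case True
  then show ?thesis
    using scaleR_left_mono[OF le_modulus(1) True, of x] scaleR_left_mono[OF le_modulus(2) True, of x]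
    by (intro modulus_leI) auto
next
  case False
  then have "0 \<le> - c" by simp
  from scaleR_left_mono[OF le_modulus(1) this, of x] scaleR_left_mono[OF le_modulus(2) this, of x]
  show ?thesis using False by (intro modulus_leI) auto
qed

lemma modulus_le_0D: "modulus x \<le> 0 \<Longrightarrow> x = 0"
  using le_modulus[of x] by (metis neg_le_0_iff_le order.antisym order_trans)

lemma norm_modulus [simp]: "norm (modulus x) = norm x"
  by (intro antisym lattice_norm) (simp_all add: modulus_def[symmetric])

lemma norm_mono_modulus: "modulus x \<le> y \<Longrightarrow> norm x \<le> norm y"
  by (rule lattice_norm) (metis modulus_def le_modulus(1) order_trans)

lemma norm_mono_pos: "0 \<le> x \<Longrightarrow> x \<le> y \<Longrightarrow> norm x \<le> norm (y :: 'a::banach_lattice)"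
  by (rule norm_mono_modulus) simp

text \<open>If f n >= 0 tends to x, the positive part of -x lies below the modulus of f n - x, so
  the lattice norm forces it to vanish.\<close>

lemma closed_nonneg: "closed {x :: 'a::banach_lattice. 0 \<le> x}"
  unfolding closed_sequential_limits
proof (intro allI impI, elim conjE)
  fix f and x :: 'a
  assume f: "\<forall>n. f n \<in> {x. 0 \<le> x}" and lim: "f \<longlonglongrightarrow> x"
  have "norm (sup (- x) 0) \<le> norm (f n - x)" for n
  proof (rule norm_mono_modulus[where y = "modulus (f n - x)", simplified])
    have "- x \<le> f n - x" using f by simp
    also have "\<dots> \<le> modulus (f n - x)" by (rule le_modulus)
    finally show "modulus (sup (- x) 0) \<le> modulus (f n - x)" by simp
  qed
  moreover have "(\<lambda>n. norm (f n - x)) \<longlonglongrightarrow> 0"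
    using lim by (simp add: LIM_zero_iff tendsto_norm_zero_iff)
  ultimately have "norm (sup (- x) 0) \<le> 0"
    by (intro tendsto_lowerbound[of "\<lambda>n. norm (f n - x)" 0 sequentially]) auto
  then have "sup (- x) 0 = 0" by simp
  then have "- x \<le> 0" by (metis sup_ge1)
  then show "x \<in> {x. 0 \<le> x}" by simp
qed

lemma tendsto_le_banach_lattice:
  fixes f g :: "nat \<Rightarrow> 'a::banach_lattice"
  assumes "f \<longlonglongrightarrow> x" "g \<longlonglongrightarrow> y" "\<And>n. f n \<le> g n"
  shows "x \<le> y"
proof -
  have "y - x \<in> {x. 0 \<le> x}"
    by (rule closed_sequentially[OF closed_nonneg, of "\<lambda>n. g n - f n"])
      (use assms in \<open>auto intro: tendsto_diff\<close>)
  then show ?thesis by simp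
qed

lemma archimedean:
  fixes x y :: "'a::banach_lattice"
  assumes "\<And>t. t > 0 \<Longrightarrow> x \<le> t *\<^sub>R y"
  shows "x \<le> 0"
proof (rule tendsto_le_banach_lattice[of "\<lambda>_. x" _ "\<lambda>n. inverse (real (Suc n)) *\<^sub>R y"])
  show "(\<lambda>n. inverse (real (Suc n)) *\<^sub>R y) \<longlonglongrightarrow> 0"
    using tendsto_scaleR[OF LIMSEQ_inverse_real_of_nat tendsto_const, of y] by simp
qed (use assms in auto)

text \<open>A discrete intermediate value theorem: along the chain \<open>x - k/n u\<close>, which descends
  from positive to negative in steps of \<open>u/n\<close>, some term is at most \<open>u/n\<close> in modulus.\<close>

lemma grid_elimination:
  fixes x u h b :: "'a::banach_lattice" and n :: nat
  assumes n: "n > 0" and xu: "modulus x \<le> u"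
    and le: "\<And>k::int. \<bar>k\<bar> \<le> int n \<Longrightarrow> b \<le> sup h (modulus (x - (of_int k / of_nat n) *\<^sub>R u))"
  shows "b \<le> sup h ((1 / of_nat n) *\<^sub>R u)"
proof -
  define \<delta> where "\<delta> = (1 / of_nat n :: real) *\<^sub>R u"
  \<comment> \<open>The index is shifted by \<open>n\<close>: as \<open>j\<close> runs from 0 to 2n,
    the chain descends from x + u >= 0 to x - u <= 0.\<close>
  define v where "v j = x - (of_int (int j - int n) / of_nat n :: real) *\<^sub>R u" for j :: nat
  have u: "0 \<le> u" using modulus_nonneg xu by (rule order_trans)
  have \<delta>: "0 \<le> \<delta>" using u by (simp add: \<delta>_def scaleR_nonneg_nonneg)
  have step: "v j = v (Suc j) + \<delta>" for j
  proof -
    have "of_int (int j - int n) / of_nat n = (of_int (int (Suc j) - int n) / of_nat n - 1 / of_nat n :: real)"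
      by (simp flip: diff_divide_distrib)
    then show ?thesis unfolding v_def \<delta>_def by (simp only: scaleR_diff_left) simp
  qed
  \<comment> \<open>The critical case is \<open>v (Suc j)\<close> negative. Its negative and
    \<open>v j\<close> add up to \<open>\<delta>\<close>, so their infimum is at most half of
    \<open>\<delta>\<close>.\<close>
  have key: "inf (v j) (modulus (v (Suc j))) \<le> sup (v (Suc j)) \<delta>" for j
  proof -
    let ?w = "v (Suc j)"
    define t where "t = inf (- ?w) (?w + \<delta>)"
    have "t + t \<le> - ?w + (?w + \<delta>)"
      unfolding t_def by (intro add_mono) auto
    then have tt: "2 *\<^sub>R t \<le> \<delta>" by (simp add: scaleR_2)
    have "(1/2) *\<^sub>R (2 *\<^sub>R t) \<le> (1/2) *\<^sub>R \<delta>" using tt by (rule scaleR_left_mono) simp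
    also have "\<dots> \<le> 1 *\<^sub>R \<delta>" using \<delta> by (intro scaleR_right_mono) auto
    finally have t: "t \<le> \<delta>" by simp
    have "inf (v j) (modulus ?w) = inf (sup ?w (- ?w)) (?w + \<delta>)"
      unfolding step[of j] modulus_def by (rule inf.commute)
    also have "\<dots> \<le> sup (inf ?w (?w + \<delta>)) t" unfolding t_def by (rule inf_sup_le_sup_inf)
    also have "\<dots> \<le> sup ?w \<delta>" using t by (intro sup_mono) auto
    finally show ?thesis .
  qed
  have le': "b \<le> sup h (modulus (v j))" if "j \<le> 2 * n" for j
    using le[of "int j - int n"] that by (simp add: v_def)
  \<comment> \<open>This invariant removes the modulus: \<open>v 0\<close> is its own modulus, the
    error of each step is absorbed by the supremum with \<open>\<delta>\<close>, and at j = 2n the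
    term \<open>v j\<close> is negative and drops out.\<close>
  have "j \<le> 2 * n \<Longrightarrow> b \<le> sup (v j) (sup h \<delta>)" for j
  proof (induction j)
    case 0
    have "0 \<le> x + u" using add_left_mono[OF order_trans[OF le_modulus(2) xu], of x] by simp
    then have "modulus (v 0) = v 0" using n by (simp add: v_def)
    with le'[of 0] have "b \<le> sup h (v 0)" by simp
    also have "\<dots> \<le> sup (v 0) (sup h \<delta>)" by (simp add: le_supI2)
    finally show ?case .
  next
    case (Suc j)
    let ?b = "sup h \<delta>"
    have "b \<le> sup h (modulus (v (Suc j)))" using le' Suc by simp
    also have "\<dots> \<le> sup (modulus (v (Suc j))) ?b" by (simp add: le_supI2)
    finally have "b \<le> inf (sup (v j) ?b) (sup (modulus (v (Suc j))) ?b)" using Suc by simp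
    also have "\<dots> \<le> sup (inf (v j) (sup (modulus (v (Suc j))) ?b)) (inf ?b (sup (modulus (v (Suc j))) ?b))"
      by (rule inf_sup_le_sup_inf)
    also have "\<dots> \<le> sup (inf (sup (modulus (v (Suc j))) ?b) (v j)) ?b"
      by (simp add: inf.commute le_supI2)
    also have "\<dots> \<le> sup (sup (inf (modulus (v (Suc j))) (v j)) (inf ?b (v j))) ?b"
      by (rule sup_mono[OF inf_sup_le_sup_inf order_refl])
    also have "\<dots> \<le> sup (sup (sup (v (Suc j)) \<delta>) ?b) ?b"
      using key[of j] by (intro sup_mono) (auto simp: inf.commute)
    also have "\<dots> = sup (v (Suc j)) ?b"
      by (simp add: ac_simps)
    finally show ?case .
  qed
  from this[of "2 * n"] have "b \<le> sup (x - u) (sup h \<delta>)" using n by (simp add: v_def)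
  moreover have "x - u \<le> 0" using order_trans[OF le_modulus(1) xu] by simp
  then have "x - u \<le> sup h \<delta>" using \<delta> by (meson order_trans sup_ge2)
  ultimately show ?thesis by (simp add: \<delta>_def sup_absorb2)
qed

section \<open>The complexification\<close>

interpretation cvec: vector_space "cscale :: complex \<Rightarrow> 'r::banach_lattice cvec \<Rightarrow> 'r cvec"
  by unfold_locales (auto simp: cscale_def algebra_simps)

lemma cscale_of_real [simp]: "cscale (of_real t) z = t *\<^sub>R z"
  by (cases z) (simp add: cscale_def)

lemma norm_cscale_le: "norm (cscale a b) \<le> norm a * norm b * 4"
proof -
  have *: "norm (s *\<^sub>R fst b) \<le> cmod a * norm b" "norm (s *\<^sub>R snd b) \<le> cmod a * norm b"
    if "\<bar>s\<bar> \<le> cmod a" for s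
    using that norm_fst_le[of "fst b" "snd b"] norm_snd_le[of "snd b" "fst b"]
    by (auto intro!: mult_mono)
  have "norm (cscale a b) \<le> norm (fst (cscale a b)) + norm (snd (cscale a b))"
    by (metis norm_Pair_le prod.collapse)
  also have "\<dots> \<le> (norm (Re a *\<^sub>R fst b) + norm (Im a *\<^sub>R snd b)) +
      (norm (Re a *\<^sub>R snd b) + norm (Im a *\<^sub>R fst b))"
    unfolding cscale_def fst_conv snd_conv
    by (intro add_mono norm_triangle_ineq norm_triangle_ineq4)
  also have "\<dots> \<le> norm a * norm b * 4"
    using *(1)[OF abs_Re_le_cmod] *(1)[OF abs_Im_le_cmod] *(2)[OF abs_Re_le_cmod] *(2)[OF abs_Im_le_cmod]
    by linarith
  finally show ?thesis .
qed

lemma bounded_bilinear_cscale: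
  "bounded_bilinear (cscale :: complex \<Rightarrow> 'r::banach_lattice cvec \<Rightarrow> 'r cvec)"
proof
  show "\<exists>K. \<forall>a b. norm (cscale a b :: 'r cvec) \<le> norm a * norm b * K"
    using norm_cscale_le by blast
qed (auto simp: cscale_def algebra_simps)

lemmas tendsto_cscale = bounded_bilinear.tendsto[OF bounded_bilinear_cscale]

text \<open>This is the real part of e^(-it) z, so multiplying \<open>z\<close> by \<open>c\<close>
  merely rescales it and shifts \<open>t\<close> by \<open>Arg c\<close>.\<close>

definition rotated :: "'r::banach_lattice cvec \<Rightarrow> real \<Rightarrow> 'r" where
  "rotated z t = cos t *\<^sub>R fst z + sin t *\<^sub>R snd z"

lemma rotated_lipschitz:
  "rotated z t \<le> rotated z s + \<bar>t - s\<bar> *\<^sub>R (modulus (fst z) + modulus (snd z))"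
proof -
  have c: "\<bar>cos t - cos s\<bar> \<le> \<bar>t - s\<bar>" and s: "\<bar>sin t - sin s\<bar> \<le> \<bar>t - s\<bar>"
    using field_differentiable_bound[of UNIV cos "\<lambda>x. - sin x" 1 t s]
      field_differentiable_bound[of UNIV sin cos 1 t s]
    by (auto intro!: derivative_eq_intros)
  have *: "a *\<^sub>R x \<le> b *\<^sub>R modulus x" if "\<bar>a\<bar> \<le> b" for a b and x :: 'a
  proof -
    have "a *\<^sub>R x \<le> \<bar>a\<bar> *\<^sub>R modulus x"
      using le_modulus(1) modulus_scaleR_le by (rule order_trans)
    also have "\<dots> \<le> b *\<^sub>R modulus x" using that by (intro scaleR_right_mono) auto
    finally show ?thesis .
  qed
  have "rotated z t - rotated z s = (cos t - cos s) *\<^sub>R fst z + (sin t - sin s) *\<^sub>R snd z"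
    by (simp add: rotated_def scaleR_diff_left)
  also have "\<dots> \<le> \<bar>t - s\<bar> *\<^sub>R (modulus (fst z) + modulus (snd z))"
    unfolding scaleR_add_right by (intro add_mono * c s)
  finally show ?thesis by (metis add.commute diff_le_eq)
qed

text \<open>The suprema over equidistant finite sets of angles form a Cauchy sequence.\<close>

lemma ex_lub_rotated:
  fixes z :: "'r::banach_lattice cvec"
  shows "\<exists>m. (\<forall>t. rotated z t \<le> m) \<and> (\<forall>u. (\<forall>t. rotated z t \<le> u) \<longrightarrow> m \<le> u)"
proof -
  define h where "h = modulus (fst z) + modulus (snd z)"
  have h: "0 \<le> h" by (simp add: h_def)
  define \<epsilon> where "\<epsilon> n = 2 * pi * inverse (real (Suc n))" for n
  define G where "G n = (\<lambda>k. rotated z (of_nat k * \<epsilon> n)) ` {..Suc n}" for n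
  define a where "a n = Sup_fin (G n)" for n
  have G: "finite (G n)" "G n \<noteq> {}" for n by (auto simp: G_def)
  have \<epsilon>: "\<epsilon> n > 0" for n by (simp add: \<epsilon>_def)
  have \<epsilon>0: "\<epsilon> \<longlonglongrightarrow> 0"
    unfolding \<epsilon>_def using tendsto_mult[OF tendsto_const LIMSEQ_inverse_real_of_nat, of "2 * pi"] by simp
  have least: "a n \<le> u" if "\<And>t. rotated z t \<le> u" for n u
    unfolding a_def using G that by (intro Sup_fin.boundedI) (auto simp: G_def)
  \<comment> \<open>\<open>a n\<close> lies below every upper bound of the rotations and fails to be
    one itself by at most \<open>\<epsilon> n *\<^sub>R h\<close>. Comparing two indices gives the
    Cauchy property, and the limit is the supremum.\<close>
  have upper: "rotated z t \<le> a n + \<epsilon> n *\<^sub>R h" for t n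
  proof -
    obtain t' where t': "0 \<le> t'" "t' < 2 * pi" "cos t = cos t'" "sin t = sin t'"
      using sincos_total_2pi[of "cos t" "sin t"] by auto
    define k where "k = nat \<lfloor>t' / \<epsilon> n\<rfloor>"
    have k: "of_nat k = of_int \<lfloor>t' / \<epsilon> n\<rfloor>" using t' \<epsilon>[of n] by (simp add: k_def)
    have "of_nat k \<le> t' / \<epsilon> n" "t' / \<epsilon> n < of_nat k + 1" unfolding k by linarith+
    then have k1: "of_nat k * \<epsilon> n \<le> t'" "t' < of_nat k * \<epsilon> n + \<epsilon> n"
      using \<epsilon>[of n] by (simp_all add: field_simps)
    have "of_nat (Suc n) * \<epsilon> n = 2 * pi" by (simp add: \<epsilon>_def)
    then have "of_nat k * \<epsilon> n < of_nat (Suc n) * \<epsilon> n" using k1 t' by linarith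
    then have "k < Suc n" using \<epsilon>[of n] by (simp only: mult_less_cancel_right_pos of_nat_less_iff)
    then have mem: "rotated z (of_nat k * \<epsilon> n) \<in> G n" by (auto simp: G_def)
    have "rotated z t = rotated z t'" by (simp add: rotated_def t')
    also have "\<dots> \<le> rotated z (of_nat k * \<epsilon> n) + \<bar>t' - of_nat k * \<epsilon> n\<bar> *\<^sub>R h"
      unfolding h_def by (rule rotated_lipschitz)
    also have "\<dots> \<le> a n + \<epsilon> n *\<^sub>R h"
      unfolding a_def using h k1
      by (intro add_mono scaleR_right_mono Sup_fin.coboundedI G mem) auto
    finally show ?thesis .
  qed
  have le: "a m - a n \<le> (\<epsilon> m + \<epsilon> n) *\<^sub>R h" for m n
  proof -
    have "a m - a n \<le> \<epsilon> n *\<^sub>R h" using least[OF upper, of m n] by (simp only: diff_le_eq add.commute)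
    also have "\<dots> \<le> (\<epsilon> m + \<epsilon> n) *\<^sub>R h" using \<epsilon>[of m] h by (intro scaleR_right_mono) auto
    finally show ?thesis .
  qed
  have dist: "norm (a m - a n) \<le> \<epsilon> m * norm h + \<epsilon> n * norm h" for m n
  proof -
    have "norm (a m - a n) \<le> norm ((\<epsilon> m + \<epsilon> n) *\<^sub>R h)"
      using le[of m n] le[of n m] by (intro norm_mono_modulus modulus_leI) (auto simp: add.commute)
    also have "\<dots> = \<epsilon> m * norm h + \<epsilon> n * norm h"
      unfolding norm_scaleR using \<epsilon>[of m] \<epsilon>[of n] by (simp add: distrib_right)
    finally show ?thesis .
  qed
  have "Cauchy a"
  proof (rule CauchyI)
    fix e :: real assume "e > 0"
    have "(\<lambda>n. \<epsilon> n * norm h) \<longlonglongrightarrow> 0" using tendsto_mult[OF \<epsilon>0 tendsto_const, of "norm h"] by simp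
    then have "\<forall>\<^sub>F n in sequentially. \<epsilon> n * norm h < e / 2"
      using \<open>e > 0\<close> by (intro order_tendstoD) auto
    then obtain N where N: "\<And>n. n \<ge> N \<Longrightarrow> \<epsilon> n * norm h < e / 2"
      by (auto simp: eventually_sequentially)
    show "\<exists>M. \<forall>m\<ge>M. \<forall>n\<ge>M. norm (a m - a n) < e"
    proof (intro exI[of _ N] allI impI)
      fix m n assume "N \<le> m" "N \<le> n"
      then show "norm (a m - a n) < e" using dist[of m n] N[of m] N[of n] by linarith
    qed
  qed
  then obtain l where l: "a \<longlonglongrightarrow> l" by (auto simp: Cauchy_convergent_iff convergent_def)
  have "(\<lambda>n. a n + \<epsilon> n *\<^sub>R h) \<longlonglongrightarrow> l"
    using tendsto_add[OF l tendsto_scaleR[OF \<epsilon>0 tendsto_const]] by simp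
  from tendsto_le_banach_lattice[OF tendsto_const this upper] have "\<forall>t. rotated z t \<le> l" by blast
  moreover have "l \<le> u" if "\<forall>t. rotated z t \<le> u" for u
    using tendsto_le_banach_lattice[OF l tendsto_const, of u] least that by blast
  ultimately show ?thesis by blast
qed

lemma rotated_le_cabs: "rotated z t \<le> cabs z"
  and cabs_least: "(\<And>t. rotated z t \<le> u) \<Longrightarrow> cabs z \<le> u"
proof -
  let ?Q = "\<lambda>m. (\<forall>t. rotated z t \<le> m) \<and> (\<forall>u. (\<forall>t. rotated z t \<le> u) \<longrightarrow> m \<le> u)"
  have "\<exists>!m. ?Q m" using ex_lub_rotated[of z] by (metis order.antisym)
  then have "?Q (THE m. ?Q m)" by (rule theI')
  moreover have "cabs z = (THE m. ?Q m)" by (simp add: cabs_def rotated_def)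
  ultimately have Q: "?Q (cabs z)" by simp
  then show "rotated z t \<le> cabs z" by blast
  from Q show "(\<And>t. rotated z t \<le> u) \<Longrightarrow> cabs z \<le> u" by blast
qed

lemma modulus_fst_le_cabs: "modulus (fst z) \<le> cabs z"
  using rotated_le_cabs[of z 0] rotated_le_cabs[of z pi] by (intro modulus_leI) (auto simp: rotated_def)

lemma modulus_snd_le_cabs: "modulus (snd z) \<le> cabs z"
  using rotated_le_cabs[of z "pi/2"] rotated_le_cabs[of z "- (pi/2)"]
  by (intro modulus_leI) (auto simp: rotated_def)

lemma cabs_nonneg [simp]: "0 \<le> cabs z"
  using modulus_nonneg modulus_fst_le_cabs by (rule order_trans)

lemma cabs_le_0D: "cabs z \<le> 0 \<Longrightarrow> z = 0"
  using modulus_fst_le_cabs[of z] modulus_snd_le_cabs[of z]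
  by (metis modulus_le_0D order_trans prod.collapse zero_prod_def)

lemma cabs_le: "cabs z \<le> modulus (fst z) + modulus (snd z)"
proof (rule cabs_least)
  fix t
  have *: "a *\<^sub>R x \<le> modulus x" if "\<bar>a\<bar> \<le> 1" for a and x :: 'a
  proof -
    have "a *\<^sub>R x \<le> \<bar>a\<bar> *\<^sub>R modulus x"
      using le_modulus(1) modulus_scaleR_le by (rule order_trans)
    also have "\<dots> \<le> 1 *\<^sub>R modulus x" using that by (intro scaleR_right_mono) auto
    finally show ?thesis by simp
  qed
  show "rotated z t \<le> modulus (fst z) + modulus (snd z)"
    unfolding rotated_def by (intro add_mono *) auto
qed

lemma cabs_triangle: "cabs (z + w) \<le> cabs z + cabs w"
proof (rule cabs_least)
  fix t
  have "rotated (z + w) t = rotated z t + rotated w t" by (simp add: rotated_def algebra_simps)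
  also have "\<dots> \<le> cabs z + cabs w" by (intro add_mono rotated_le_cabs)
  finally show "rotated (z + w) t \<le> cabs z + cabs w" .
qed

lemma rotated_cscale: "rotated (cscale c z) t = cmod c *\<^sub>R rotated z (t - Arg c)"
proof -
  have c: "Re c = cmod c * cos (Arg c)" "Im c = cmod c * sin (Arg c)"
    using rcis_cmod_Arg[of c] by (metis Re_rcis, metis Im_rcis)
  show ?thesis
    unfolding rotated_def cscale_def fst_conv snd_conv c
    by (simp add: cos_diff sin_diff algebra_simps)
qed

lemma cabs_cscale_le: "cabs (cscale c z) \<le> cmod c *\<^sub>R cabs z"
  by (rule cabs_least) (simp add: rotated_cscale scaleR_left_mono rotated_le_cabs)

lemma cabs_cscale: "cabs (cscale c z) = cmod c *\<^sub>R cabs z"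
proof (cases "c = 0")
  case True
  then show ?thesis
    using order.antisym[OF _ cabs_nonneg] cabs_cscale_le[of c z] by simp
next
  case False
  have "cabs z = cabs (cscale (1 / c) (cscale c z))" using False by simp
  also have "\<dots> \<le> (1 / cmod c) *\<^sub>R cabs (cscale c z)"
    using cabs_cscale_le[of "1 / c" "cscale c z"] by (simp add: norm_divide)
  finally have "cmod c *\<^sub>R cabs z \<le> cmod c *\<^sub>R ((1 / cmod c) *\<^sub>R cabs (cscale c z))"
    by (intro scaleR_left_mono) auto
  also have "\<dots> = cabs (cscale c z)" using False by simp
  finally show ?thesis using cabs_cscale_le order.antisym by blast
qed

lemma norm_le_cnorm: "norm z \<le> 2 * cnorm z"
proof -
  have "norm z \<le> norm (fst z) + norm (snd z)" by (metis norm_Pair_le prod.collapse)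
  also have "\<dots> \<le> 2 * cnorm z"
    using norm_mono_modulus[OF modulus_fst_le_cabs, of z] norm_mono_modulus[OF modulus_snd_le_cabs, of z]
    by (simp add: cnorm_def)
  finally show ?thesis .
qed

lemma cnorm_le_norm: "cnorm z \<le> 2 * norm z"
proof -
  have "cnorm z \<le> norm (modulus (fst z) + modulus (snd z))"
    unfolding cnorm_def by (intro norm_mono_pos cabs_le) simp
  also have "\<dots> \<le> norm (fst z) + norm (snd z)"
    using norm_triangle_ineq[of "modulus (fst z)" "modulus (snd z)"] by simp
  also have "\<dots> \<le> 2 * norm z"
    using norm_fst_le[of "fst z" "snd z"] norm_snd_le[of "snd z" "fst z"] by simp
  finally show ?thesis .
qed

text \<open>\<open>cnorm\<close> and the product norm dominate each other up to a factor 2, so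
  boundedness can be tested in the product norm, where the theory of \<open>bounded_linear\<close>
  applies.\<close>

lemma bounded_cop_iff:
  "bounded_cop T \<longleftrightarrow> bounded_linear T \<and> (\<forall>c z. T (cscale c z) = cscale c (T z))"
proof
  assume T: "bounded_cop T"
  then obtain K where K: "\<And>z. cnorm (T z) \<le> K * cnorm z" by (auto simp: bounded_cop_def)
  have "T (t *\<^sub>R z) = t *\<^sub>R T z" for t z
    using T unfolding bounded_cop_def by (metis cscale_of_real)
  moreover have "norm (T z) \<le> norm z * (4 * \<bar>K\<bar>)" for z
  proof -
    have "norm (T z) \<le> 2 * (K * cnorm z)" using norm_le_cnorm[of "T z"] K[of z] by linarith
    also have "\<dots> \<le> 2 * (\<bar>K\<bar> * cnorm z)"
      by (intro mult_left_mono mult_right_mono) (auto simp: cnorm_def)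
    also have "\<dots> \<le> 2 * (\<bar>K\<bar> * (2 * norm z))"
      using cnorm_le_norm[of z] by (intro mult_mono) (auto simp: cnorm_def)
    finally show ?thesis by (simp add: mult_ac)
  qed
  ultimately show "bounded_linear T \<and> (\<forall>c z. T (cscale c z) = cscale c (T z))"
    using T unfolding bounded_cop_def by (auto intro!: bounded_linear_intro)
next
  assume T: "bounded_linear T \<and> (\<forall>c z. T (cscale c z) = cscale c (T z))"
  then obtain K where K: "K \<ge> 0" "\<And>z. norm (T z) \<le> norm z * K"
    using bounded_linear.nonneg_bounded by blast
  have "cnorm (T z) \<le> (4 * K) * cnorm z" for z
  proof -
    have "cnorm (T z) \<le> 2 * (norm z * K)" using cnorm_le_norm[of "T z"] K(2)[of z] by linarith
    also have "\<dots> \<le> 2 * ((2 * cnorm z) * K)"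
      using norm_le_cnorm[of z] K(1) by (intro mult_mono) (auto simp: cnorm_def)
    finally show ?thesis by (simp add: mult_ac)
  qed
  then show "bounded_cop T"
    using T unfolding bounded_cop_def by (auto simp: linear_simps(1))
qed

text \<open>The 4 collects two norm comparisons: a factor 2 to scale \<open>z\<close> into the unit
  ball of \<open>cnorm\<close>, and a factor 2 to return from \<open>cnorm\<close> to the norm of
  the image.\<close>

lemma norm_le_opnorm:
  assumes "bounded_cop S"
  shows "norm (S z) \<le> 4 * opnorm S * norm z"
proof (cases "z = 0")
  case True
  then show ?thesis using assms by (simp add: bounded_cop_iff linear_simps)
next
  case False
  obtain K where K: "\<And>z. cnorm (S z) \<le> K * cnorm z" using assms by (auto simp: bounded_cop_def)
  define t where "t = 1 / (2 * norm z)"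
  have t: "t > 0" using False by (simp add: t_def)
  have "cnorm (t *\<^sub>R z) \<le> 1" using cnorm_le_norm[of "t *\<^sub>R z"] False by (simp add: t_def)
  moreover have "bdd_above {cnorm (S z) | z. cnorm z \<le> 1}"
  proof (rule bdd_aboveI, clarify)
    fix w :: "'a cvec" assume "cnorm w \<le> 1"
    have "cnorm (S w) \<le> K * cnorm w" by (rule K)
    also have "\<dots> \<le> \<bar>K\<bar> * 1" using \<open>cnorm w \<le> 1\<close> by (intro mult_mono) (auto simp: cnorm_def)
    finally show "cnorm (S w) \<le> \<bar>K\<bar>" by simp
  qed
  ultimately have "cnorm (S (t *\<^sub>R z)) \<le> opnorm S"
    unfolding opnorm_def by (intro cSup_upper CollectI exI[of _ "t *\<^sub>R z"] conjI refl)
  with norm_le_cnorm[of "S (t *\<^sub>R z)"] have "norm (S (t *\<^sub>R z)) \<le> 2 * opnorm S" by linarith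
  then have "t * norm (S z) \<le> 2 * opnorm S"
    using assms t by (simp add: bounded_cop_iff linear_simps)
  then show ?thesis using False by (simp add: t_def field_simps)
qed

section \<open>Resolvents of eventually positive operators\<close>

lemma cpos_iff: "z \<in> cpos \<longleftrightarrow> 0 \<le> fst z \<and> snd z = 0"
  by (cases z) (auto simp: cpos_def)

lemma closed_cpos: "closed (cpos :: 'r::banach_lattice cvec set)"
proof -
  have "(cpos :: 'r cvec set) = {x. 0 \<le> x} \<times> {0}" by (auto simp: cpos_iff)
  then show ?thesis by (metis closed_Times closed_nonneg closed_singleton)
qed

lemma cpos_zero: "0 \<in> cpos"
  by (simp add: cpos_iff)

lemma cpos_add: "z \<in> cpos \<Longrightarrow> w \<in> cpos \<Longrightarrow> z + w \<in> cpos"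
  by (simp add: cpos_iff)

lemma cpos_scaleR: "z \<in> cpos \<Longrightarrow> 0 \<le> t \<Longrightarrow> t *\<^sub>R z \<in> cpos"
  by (simp add: cpos_iff scaleR_nonneg_nonneg)

section \<open>Operator series with nonnegative coefficients\<close>

lemma bounded_linear_funpow:
  fixes A :: "'a::real_normed_vector \<Rightarrow> 'a"
  assumes "bounded_linear A"
  shows "bounded_linear (A ^^ n)"
  by (induction n) (auto simp: o_def id_def intro: bounded_linear_compose[OF assms])

lemma norm_funpow_le:
  fixes A :: "'a::real_normed_vector \<Rightarrow> 'a"
  assumes "0 \<le> K" "\<And>z. norm (A z) \<le> K * norm z"
  shows "norm ((A ^^ n) z) \<le> K ^ n * norm z"
proof (induction n)
  case (Suc n)
  have "norm ((A ^^ Suc n) z) \<le> K * norm ((A ^^ n) z)" using assms(2) by simp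
  also have "\<dots> \<le> K * (K ^ n * norm z)" using Suc assms(1) by (rule mult_left_mono)
  finally show ?case by (simp add: mult_ac)
qed simp

text \<open>Iterating \<open>rec\<close> leaves the remainder
  \<open>\<beta> ^ n *\<^sub>R Q ((A ^^ n) z)\<close>, which decays geometrically. Two cases are
  covered: Q = R(l) with A = T, \<open>\<beta>\<close> = 1/l and C division by l; and Q = R(l - h)
  with A = C = R(l) and \<open>\<beta>\<close> = h.\<close>

lemma neumann_sums:
  fixes Q C A :: "'a::real_normed_vector \<Rightarrow> 'a"
  assumes Q: "bounded_linear Q"
    and A: "0 \<le> K" "\<And>z. norm (A z) \<le> K * norm z" and "0 \<le> \<beta>" "\<beta> * K < 1"
    and rec: "\<And>w. Q w = C w + \<beta> *\<^sub>R Q (A w)"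
  shows "(\<lambda>j. \<beta> ^ j *\<^sub>R C ((A ^^ j) z)) sums Q z"
proof -
  obtain M where M: "\<And>z. norm (Q z) \<le> norm z * M" "0 \<le> M"
    using bounded_linear.nonneg_bounded[OF Q] by blast
  have partial: "Q z - (\<Sum>j<n. \<beta> ^ j *\<^sub>R C ((A ^^ j) z)) = \<beta> ^ n *\<^sub>R Q ((A ^^ n) z)" for n
  proof (induction n)
    case (Suc n)
    have "Q z - (\<Sum>j<Suc n. \<beta> ^ j *\<^sub>R C ((A ^^ j) z))
        = \<beta> ^ n *\<^sub>R (Q ((A ^^ n) z) - C ((A ^^ n) z))"
      using Suc by (simp add: algebra_simps)
    also have "\<dots> = \<beta> ^ Suc n *\<^sub>R Q ((A ^^ Suc n) z)"
      using rec[of "(A ^^ n) z"] by (simp add: mult.commute)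
    finally show ?case .
  qed simp
  have "(\<lambda>n. Q z - (\<Sum>j<n. \<beta> ^ j *\<^sub>R C ((A ^^ j) z))) \<longlonglongrightarrow> 0"
    unfolding partial
  proof (rule Lim_null_comparison[where g = "\<lambda>n. (\<beta> * K) ^ n * (norm z * M)"])
    show "\<forall>\<^sub>F n in sequentially. norm (\<beta> ^ n *\<^sub>R Q ((A ^^ n) z)) \<le> (\<beta> * K) ^ n * (norm z * M)"
    proof (intro always_eventually allI)
      fix n
      have "norm (\<beta> ^ n *\<^sub>R Q ((A ^^ n) z)) \<le> \<beta> ^ n * (norm ((A ^^ n) z) * M)"
        using M(1) \<open>0 \<le> \<beta>\<close> by (simp add: mult_left_mono)
      also have "\<dots> \<le> \<beta> ^ n * ((K ^ n * norm z) * M)"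
        using norm_funpow_le[OF A] M(2) \<open>0 \<le> \<beta>\<close> by (intro mult_left_mono mult_right_mono) auto
      finally show "norm (\<beta> ^ n *\<^sub>R Q ((A ^^ n) z)) \<le> (\<beta> * K) ^ n * (norm z * M)"
        by (simp add: power_mult_distrib mult_ac)
    qed
    have "(\<lambda>n. (\<beta> * K) ^ n) \<longlonglongrightarrow> 0"
      using assms by (intro LIMSEQ_realpow_zero) auto
    then show "(\<lambda>n. (\<beta> * K) ^ n * (norm z * M)) \<longlonglongrightarrow> 0"
      using tendsto_mult_left_zero by blast
  qed
  then have "(\<lambda>n. Q z - (Q z - (\<Sum>j<n. \<beta> ^ j *\<^sub>R C ((A ^^ j) z)))) \<longlonglongrightarrow> Q z - 0"
    by (intro tendsto_intros)
  then show ?thesis by (simp add: sums_def)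
qed

text \<open>As far as lower bounds are concerned, \<open>A\<close> acts like the scalar
  \<open>a\<close>; a series in \<open>A\<close> with nonnegative coefficients then acts like its
  scalar sum \<open>b\<close>. The exponent \<open>i\<close> has to vary in the induction, since
  expanding the innermost \<open>B\<close> raises it by every \<open>j\<close>.\<close>

lemma series_domination:
  fixes G A B :: "'r::banach_lattice cop" and c :: "nat \<Rightarrow> real"
  assumes G: "bounded_linear G" and B: "bounded_linear B"
    and c: "\<And>j. 0 \<le> c j"
    and Bs: "\<And>z. (\<lambda>j. c j *\<^sub>R (A ^^ j) z) sums B z"
    and bs: "(\<lambda>j. c j * a ^ j) sums b"
    and dom: "\<And>i. G ((A ^^ i) u) - a ^ i *\<^sub>R v \<in> cpos"
  shows "G ((B ^^ k) ((A ^^ i) u)) - (b ^ k * a ^ i) *\<^sub>R v \<in> cpos"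
proof (induction k arbitrary: i)
  case 0
  then show ?case using dom by simp
next
  case (Suc k)
  note IH = Suc.IH
  have GB: "bounded_linear (\<lambda>z. G ((B ^^ k) z))"
    using bounded_linear_compose[OF G bounded_linear_funpow[OF B]] .
  define s where "s j = c j *\<^sub>R (G ((B ^^ k) ((A ^^ (j + i)) u)) - (b ^ k * a ^ (j + i)) *\<^sub>R v)" for j
  have "(\<lambda>j. G ((B ^^ k) (c j *\<^sub>R (A ^^ j) ((A ^^ i) u)))) sums G ((B ^^ k) (B ((A ^^ i) u)))"
    by (rule bounded_linear.sums[OF GB Bs])
  then have 1: "(\<lambda>j. c j *\<^sub>R G ((B ^^ k) ((A ^^ (j + i)) u))) sums G ((B ^^ Suc k) ((A ^^ i) u))"
    by (simp add: linear_simps[OF GB] funpow_add funpow_swap1)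
  have "(\<lambda>j. ((c j * a ^ j) * (b ^ k * a ^ i)) *\<^sub>R v) sums ((b * (b ^ k * a ^ i)) *\<^sub>R v)"
    by (intro bounded_linear.sums[OF bounded_linear_scaleR_left] sums_mult2 bs)
  then have 2: "(\<lambda>j. c j *\<^sub>R (b ^ k * a ^ (j + i)) *\<^sub>R v) sums ((b ^ Suc k * a ^ i) *\<^sub>R v)"
    by (simp add: power_add mult_ac)
  have "s sums (G ((B ^^ Suc k) ((A ^^ i) u)) - (b ^ Suc k * a ^ i) *\<^sub>R v)"
    using sums_diff[OF 1 2] unfolding s_def scaleR_diff_right .
  then have lim: "(\<lambda>n. \<Sum>j<n. s j) \<longlonglongrightarrow> G ((B ^^ Suc k) ((A ^^ i) u)) - (b ^ Suc k * a ^ i) *\<^sub>R v"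
    by (simp add: sums_def)
  have mem: "(\<Sum>j<n. s j) \<in> cpos" for n
  proof (induction n)
    case (Suc n)
    have "s n \<in> cpos" unfolding s_def by (intro cpos_scaleR IH c)
    then show ?case using Suc by (simp add: cpos_add)
  qed (simp add: cpos_zero)
  show ?case by (rule closed_sequentially[OF closed_cpos mem lim])
qed

section \<open>The resolvent set and lower bounds for the resolvent\<close>

lemma resolv_props:
  assumes "l \<notin> cspec T"
  shows bounded_cop_resolv: "bounded_cop (resolv T l)"
    and resolv_left: "resolv T l (cscale l z - T z) = z"
    and resolv_right: "cscale l (resolv T l z) - T (resolv T l z) = z"
proof -
  obtain S where S: "bounded_cop S" "\<And>z. S (cscale l z - T z) = z" "\<And>z. cscale l (S z) - T (S z) = z"
    using assms by (auto simp: cspec_def resolvent_set_def)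
  have "resolv T l = S"
    unfolding resolv_def by (rule inv_unique_comp) (auto simp: fun_eq_iff S)
  with S show "bounded_cop (resolv T l)" "resolv T l (cscale l z - T z) = z"
    "cscale l (resolv T l z) - T (resolv T l z) = z" by auto
qed

text \<open>Solving l x - T x = z is the fixed point problem x = (z + T x) / l. The 8 is the 4 of
  \<open>norm_cscale_le\<close> times 2 for the contraction constant 1/2. The lemma bounds the set
  whose supremum is \<open>spr\<close>.\<close>

lemma large_in_resolvent_set:
  assumes T: "bounded_cop T" and K: "0 \<le> K" "\<And>z. norm (T z) \<le> norm z * K" and l: "cmod l > 8 * K"
  shows "l \<in> resolvent_set T"
proof -
  have T': "bounded_linear T" "\<And>c z. T (cscale c z) = cscale c (T z)" using T by (auto simp: bounded_cop_iff)
  have l0: "cmod l > 0" "l \<noteq> 0" using l K(1) by auto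
  have contr: "norm (cscale (1 / l) (T x)) \<le> 1/2 * norm x" for x
  proof -
    have "norm (cscale (1 / l) (T x)) \<le> 4 / cmod l * norm (T x)"
      using norm_cscale_le[of "1 / l" "T x"] by (simp add: norm_divide mult.commute)
    also have "\<dots> \<le> 4 / cmod l * (norm x * K)" using K(2) by (intro mult_left_mono) auto
    also have "\<dots> = norm x * (4 * K / cmod l)" by simp
    also have "\<dots> \<le> norm x * (1 / 2)" using l l0 by (intro mult_left_mono) (auto simp: field_simps)
    finally show ?thesis by simp
  qed
  have ex: "\<exists>!x. cscale l x - T x = z" for z
  proof -
    have "\<exists>!x. cscale (1 / l) (z + T x) = x"
    proof (rule banach_fix_type[of "1/2"])
      have "cscale (1 / l) (z + T x) - cscale (1 / l) (z + T y) = cscale (1 / l) (T (x - y))" for x y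
        by (simp add: linear_simps[OF T'(1)] cvec.scale_right_distrib cvec.scale_right_diff_distrib)
      then show "\<forall>x y. dist (cscale (1 / l) (z + T x)) (cscale (1 / l) (z + T y)) \<le> 1 / 2 * dist x y"
        using contr by (simp add: dist_norm)
    qed auto
    moreover have "cscale (1 / l) (z + T x) = x \<longleftrightarrow> cscale l x - T x = z" for x
    proof
      assume "cscale (1 / l) (z + T x) = x"
      then have "cscale l x = cscale l (cscale (1 / l) (z + T x))" by simp
      then show "cscale l x - T x = z" using l0 by simp
    next
      assume "cscale l x - T x = z"
      then have "z + T x = cscale l x" by auto
      then show "cscale (1 / l) (z + T x) = x" using l0 by simp
    qed
    ultimately show ?thesis by simp
  qed
  define S where "S z = (THE x. cscale l x - T x = z)" for z
  have S1: "cscale l (S z) - T (S z) = z" for z unfolding S_def by (rule theI'[OF ex])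
  have S2: "S z = x" if "cscale l x - T x = z" for x z using ex[of z] S1[of z] that by blast
  have "bounded_linear S"
  proof (rule bounded_linear_intro[where K = "8 / cmod l"])
    fix x y t
    show "S (x + y) = S x + S y"
      using S1[of x] S1[of y]
      by (intro S2) (simp add: linear_simps[OF T'(1)] cvec.scale_right_distrib algebra_simps)
    show "S (t *\<^sub>R x) = t *\<^sub>R S x"
      using S1[of x] unfolding cscale_of_real[symmetric]
      by (intro S2) (simp only: T'(2) cvec.scale_left_commute[of l] cvec.scale_right_diff_distrib[symmetric])
    have "cscale (1 / l) (x + T (S x)) = cscale (1 / l) (cscale l (S x))"
      using S1[of x] by (metis diff_add_cancel)
    then have "S x = cscale (1 / l) x + cscale (1 / l) (T (S x))"
      using l0 by (simp add: cvec.scale_right_distrib)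
    then have "norm (S x) \<le> norm (cscale (1 / l) x) + norm (cscale (1 / l) (T (S x)))"
      by (metis norm_triangle_ineq)
    also have "\<dots> \<le> 4 / cmod l * norm x + 1/2 * norm (S x)"
      using norm_cscale_le[of "1 / l" x] contr[of "S x"] by (simp add: norm_divide)
    finally have "norm (S x) \<le> 2 * (4 / cmod l * norm x)" by linarith
    then show "norm (S x) \<le> norm x * (8 / cmod l)" by (simp add: mult.commute)
  qed
  moreover have "S (cscale c z) = cscale c (S z)" for c z
    using S1[of z]
    by (intro S2) (simp only: T'(2) cvec.scale_left_commute[of l] cvec.scale_right_diff_distrib[symmetric])
  ultimately have "bounded_cop S" by (simp add: bounded_cop_iff)
  then show ?thesis using S1 S2 unfolding resolvent_set_def by blast
qed

lemma le_spr:
  assumes "bounded_cop T" "l \<in> cspec T"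
  shows "cmod l \<le> spr T"
proof -
  obtain K where K: "0 \<le> K" "\<And>z. norm (T z) \<le> norm z * K"
    using assms(1) bounded_linear.nonneg_bounded[of T] by (auto simp: bounded_cop_iff)
  have "bdd_above (cmod ` cspec T)"
    using large_in_resolvent_set[OF assms(1) K] unfolding cspec_def
    by (intro bdd_aboveI[of _ "8 * K"]) (force simp: not_less[symmetric])
  then show ?thesis unfolding spr_def using assms(2) by (intro cSup_upper) auto
qed

text \<open>For large \<open>l\<close> the estimate follows from the Neumann series.  It propagates to smaller \<open>l\<close>
  because the expansion \<open>R(l - h) = \<Sum>j. h^j R(l)^(j+1)\<close> has nonnegative coefficients;
  this is why all powers of the resolvent are treated simultaneously.\<close>

lemma resolvent_domination:
  fixes T :: "'r::banach_lattice cop"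
  assumes T: "bounded_cop T" and r: "0 \<le> r"
    and res: "\<And>l::real. l > r \<Longrightarrow> complex_of_real l \<notin> cspec T"
    and dom: "\<And>n. (T ^^ n0) ((T ^^ n) u) - r ^ n *\<^sub>R v \<in> cpos"
    and l: "l > r"
  shows "(T ^^ n0) ((resolv T (of_real l) ^^ k) u) - (1 / (l - r)) ^ k *\<^sub>R v \<in> cpos"
proof -
  have T': "bounded_linear T" using T by (auto simp: bounded_cop_iff)
  have G: "bounded_linear (T ^^ n0)" using T' by (rule bounded_linear_funpow)
  define R where "R l = resolv T (complex_of_real l)" for l
  have R: "bounded_linear (R l)" if "l > r" for l
    unfolding R_def using bounded_cop_resolv[OF res[OF that]] by (simp add: bounded_cop_iff)
  have Rl: "R l (l *\<^sub>R z - T z) = z" and Rr: "l *\<^sub>R R l z - T (R l z) = z" if "l > r" for l z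
    using resolv_left[OF res[OF that]] resolv_right[OF res[OF that]] by (simp_all add: R_def)
  define good where "good l \<longleftrightarrow> (\<forall>k. (T ^^ n0) ((R l ^^ k) u) - (1 / (l - r)) ^ k *\<^sub>R v \<in> cpos)" for l
  obtain K where K: "0 \<le> K" "\<And>z. norm (T z) \<le> norm z * K"
    using bounded_linear.nonneg_bounded[OF T'] by blast
  have large: "good l" if lr: "l > r" and lK: "l > K" for l
  proof -
    have l0: "l > 0" using lr r by simp
    have s: "(\<lambda>j. (1 / l) ^ j *\<^sub>R (1 / l) *\<^sub>R ((T ^^ j) z)) sums R l z" for z
    proof (rule neumann_sums[where C = "\<lambda>w. (1 / l) *\<^sub>R w", OF R[OF lr] K(1)])
      show "norm (T z) \<le> K * norm z" for z using K(2)[of z] by (simp add: mult.commute)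
      show "1 / l * K < 1" using lK l0 by simp
      fix w
      have "w = l *\<^sub>R R l w - R l (T w)"
        using Rl[OF lr, of w] by (simp add: linear_simps[OF R[OF lr]])
      then have "(1 / l) *\<^sub>R w = (1 / l) *\<^sub>R (l *\<^sub>R R l w - R l (T w))" by (rule arg_cong)
      then show "R l w = (1 / l) *\<^sub>R w + (1 / l) *\<^sub>R R l (T w)"
        using l0 by (simp add: scaleR_diff_right)
    qed (use l0 in auto)
    have "(\<lambda>j. 1 / l * (r / l) ^ j) sums (1 / l * (1 / (1 - r / l)))"
      using lr l0 r by (intro sums_mult geometric_sums) auto
    moreover have "1 / l * (1 / (1 - r / l)) = 1 / (l - r)" using lr l0 by (simp add: field_simps)
    ultimately have b: "(\<lambda>j. (1 / l) ^ Suc j * r ^ j) sums (1 / (l - r))"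
      by (simp add: power_divide)
    show ?thesis
      unfolding good_def
    proof
      fix k
      show "(T ^^ n0) ((R l ^^ k) u) - (1 / (l - r)) ^ k *\<^sub>R v \<in> cpos"
        using series_domination[OF G R[OF lr] _ _ b dom, where k = k and i = 0] s l0
        by (simp add: mult.commute)
    qed
  qed
  have descend: "good l'" if g: "good l" and l: "r < l'" "l' \<le> l"
    and M: "0 \<le> M" "\<And>z. norm (R l z) \<le> M * norm z" "(l - l') * M < 1" for l l' M
  proof -
    define h where "h = l - l'"
    have lr: "l > r" and h: "0 \<le> h" and l': "l' = l - h" using l by (auto simp: h_def)
    have s0: "(\<lambda>j. h ^ j *\<^sub>R R l ((R l ^^ j) z)) sums R l' z" for z
    proof (rule neumann_sums[OF R[OF l(1)] M(1,2) h])
      show "h * M < 1" using M(3) by (simp add: h_def)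
      fix w
      have "l' *\<^sub>R R l w - T (R l w) = w - h *\<^sub>R R l w"
        using Rr[OF lr, of w] by (simp add: l' algebra_simps)
      then have "R l w = R l' (w - h *\<^sub>R R l w)" using Rl[OF l(1), of "R l w"] by simp
      then show "R l' w = R l w + h *\<^sub>R R l' (R l w)"
        by (simp add: linear_simps[OF R[OF l(1)]] algebra_simps)
    qed
    \<comment> \<open>The expansion starts with the first power of \<open>R l\<close>, so the
      coefficient of the zeroth power is 0. At the scalar a = 1/(l - r) the same series sums to
      1/(l' - r).\<close>
    define c where "c j = (case j of 0 \<Rightarrow> 0 | Suc i \<Rightarrow> h ^ i)" for j
    have c: "0 \<le> c j" for j using h by (simp add: c_def split: nat.split)
    have s: "(\<lambda>j. c j *\<^sub>R (R l ^^ j) z) sums R l' z" for z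
      using s0[of z] sums_Suc_iff[of "\<lambda>j. c j *\<^sub>R (R l ^^ j) z"] by (simp add: c_def)
    define a where "a = 1 / (l - r)"
    have "h * a < 1" "0 \<le> h * a" using l lr h by (simp_all add: a_def h_def field_simps)
    then have "(\<lambda>j. a * (h * a) ^ j) sums (a * (1 / (1 - h * a)))"
      by (intro sums_mult geometric_sums) auto
    moreover have "a * (1 / (1 - h * a)) = 1 / (l' - r)"
      using l lr by (simp add: a_def h_def field_simps)
    ultimately have "(\<lambda>j. c (Suc j) * a ^ Suc j) sums (1 / (l' - r))"
      by (simp add: c_def power_mult_distrib mult_ac)
    then have b: "(\<lambda>j. c j * a ^ j) sums (1 / (l' - r))"
      using sums_Suc_iff[of "\<lambda>j. c j * a ^ j"] by (simp add: c_def)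
    have dom': "(T ^^ n0) ((R l ^^ i) u) - a ^ i *\<^sub>R v \<in> cpos" for i
      using g by (simp add: good_def a_def)
    show ?thesis
      unfolding good_def
      using series_domination[OF G R[OF l(1)] c s b dom', where i = 0] by simp
  qed
  \<comment> \<open>\<open>descend\<close> reaches only as far as the norm of \<open>R l\<close>
    allows. Near \<open>m\<close> this norm has the uniform bound 2M, so a descent that starts above
    \<open>m\<close> can pass below it; the radius 1/(4M) makes (l - l') 2M < 1.\<close>
  have local: "\<exists>\<delta>>0. \<forall>l l'. r < l' \<and> l' \<le> l \<and> \<bar>l - m\<bar> < \<delta> \<and> \<bar>l' - m\<bar> < \<delta> \<and> good l \<longrightarrow> good l'"
    if m: "m > r" for m
  proof -
    obtain M where M: "M > 0" "\<And>z. norm (R m z) \<le> norm z * M"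
      using bounded_linear.pos_bounded[OF R[OF m]] by blast
    have bound: "norm (R l z) \<le> 2 * M * norm z" if l: "l > r" "\<bar>l - m\<bar> < 1 / (4 * M)" for l z
    proof -
      define w where "w = R l z"
      have "m *\<^sub>R w - T w = z - (l - m) *\<^sub>R w"
        using Rr[OF l(1), of z] by (simp add: w_def algebra_simps)
      then have "w = R m (z - (l - m) *\<^sub>R w)" using Rl[OF m, of w] by simp
      then have "norm w \<le> norm (z - (l - m) *\<^sub>R w) * M" using M(2) by metis
      also have "\<dots> \<le> (norm z + \<bar>l - m\<bar> * norm w) * M"
        using norm_triangle_ineq4[of z "(l - m) *\<^sub>R w"] M(1) by (intro mult_right_mono) auto
      also have "\<dots> = norm z * M + (\<bar>l - m\<bar> * M) * norm w" by (simp add: algebra_simps)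
      also have "\<dots> \<le> norm z * M + 1/2 * norm w"
        using l(2) M(1) by (intro add_left_mono mult_right_mono) (auto simp: field_simps)
      finally show ?thesis by (simp add: w_def mult_ac)
    qed
    have "good l'" if "r < l'" "l' \<le> l" "\<bar>l - m\<bar> < 1 / (4 * M)" "\<bar>l' - m\<bar> < 1 / (4 * M)" "good l" for l l'
    proof (rule descend[OF that(5,1,2)])
      show "norm (R l z) \<le> 2 * M * norm z" for z using bound that by auto
      have "l - l' < 2 / (4 * M)" using that(3,4) by (auto simp: abs_less_iff)
      then show "(l - l') * (2 * M) < 1" using M(1) by (simp add: field_simps)
    qed (use M in auto)
    then show ?thesis using M(1) by (intro exI[of _ "1 / (4 * M)"]) auto
  qed
  have "good l"
  proof (rule ccontr)
    assume bad: "\<not> good l"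
    \<comment> \<open>The supremum \<open>m\<close> of the bad points is finite by
      \<open>large\<close>. A point slightly above \<open>m\<close> is good, and
      \<open>local\<close> carries goodness down to a bad point within the same
      neighbourhood.\<close>
    define Z where "Z = {l. l > r \<and> \<not> good l}"
    have lZ: "l \<in> Z" using bad l by (simp add: Z_def)
    have bdd: "bdd_above Z"
      using large by (intro bdd_aboveI[of _ "max r K"]) (force simp: Z_def)
    define m where "m = Sup Z"
    have "l \<le> m" unfolding m_def using lZ bdd by (rule cSup_upper)
    then obtain \<delta> where \<delta>: "\<delta> > 0"
      "\<And>l l'. r < l' \<Longrightarrow> l' \<le> l \<Longrightarrow> \<bar>l - m\<bar> < \<delta> \<Longrightarrow> \<bar>l' - m\<bar> < \<delta> \<Longrightarrow> good l \<Longrightarrow> good l'"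
      using local[of m] l by (metis less_le_trans)
    obtain l' where l': "l' \<in> Z" "m - \<delta> < l'"
      using less_cSupD[of Z "m - \<delta>"] lZ \<delta>(1) unfolding m_def by fastforce
    have "l' \<le> m" unfolding m_def using l'(1) bdd by (rule cSup_upper)
    have "m + \<delta> / 2 \<notin> Z" using cSup_upper[OF _ bdd, of "m + \<delta> / 2"] \<delta>(1) by (auto simp: m_def)
    then have "good (m + \<delta> / 2)" using \<open>l \<le> m\<close> l \<delta>(1) by (auto simp: Z_def)
    then have "good l'"
      using \<delta>(2)[of l' "m + \<delta> / 2"] l' \<open>l' \<le> m\<close> \<delta>(1) by (auto simp: Z_def)
    then show False using l'(1) by (simp add: Z_def)
  qed
  then show ?thesis by (simp add: good_def R_def)
qed

text \<open>With \<open>E\<close> the error of the difference quotient, g w z = g a z + (w - a)(E w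
  z + D z), and \<open>E w\<close> tends to 0 in operator norm. Applied at the pole, this yields the
  residue as a pointwise limit.\<close>

lemma op_holomorphic_continuous:
  assumes hol: "op_holomorphic_on g S" and a: "a \<in> S" and g: "\<And>w. w \<in> S \<Longrightarrow> bounded_cop (g w)"
  shows "((\<lambda>w. g w z) \<longlongrightarrow> g a z) (at a within S)"
proof -
  obtain D where D: "bounded_cop D"
    and lim: "((\<lambda>w. opnorm (\<lambda>z. cscale (1 / (w - a)) (g w z - g a z) - D z)) \<longlongrightarrow> 0) (at a within S)"
    using hol a unfolding op_holomorphic_on_def by blast
  define E where "E w z = cscale (1 / (w - a)) (g w z - g a z) - D z" for w z
  have E: "bounded_cop (E w)" if "w \<in> S" for w
    unfolding bounded_cop_iff
  proof
    have "bounded_linear (g w)" "bounded_linear (g a)" "bounded_linear D"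
      using g[OF that] g[OF a] D by (simp_all add: bounded_cop_iff)
    then show "bounded_linear (E w)"
      unfolding E_def
      by (intro bounded_linear_sub bounded_linear_compose[OF
            bounded_bilinear.bounded_linear_right[OF bounded_bilinear_cscale]])
    have "g w (cscale c z) = cscale c (g w z)" "g a (cscale c z) = cscale c (g a z)"
      "D (cscale c z) = cscale c (D z)" for c z
      using g[OF that] g[OF a] D by (simp_all only: bounded_cop_def)
    then show "\<forall>c z. E w (cscale c z) = cscale c (E w z)"
      by (simp only: E_def cvec.scale_left_commute[of "1 / (w - a)"]
          flip: cvec.scale_right_diff_distrib) simp
  qed
  have "((\<lambda>w. E w z) \<longlongrightarrow> 0) (at a within S)"
  proof (rule Lim_null_comparison[where g = "\<lambda>w. 4 * opnorm (E w) * norm z"])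
    show "\<forall>\<^sub>F w in at a within S. norm (E w z) \<le> 4 * opnorm (E w) * norm z"
      using norm_le_opnorm[OF E] by (auto simp: eventually_at intro: exI[of _ 1])
    show "((\<lambda>w. 4 * opnorm (E w) * norm z) \<longlongrightarrow> 0) (at a within S)"
      using tendsto_mult_left_zero[OF tendsto_mult_right_zero[OF lim, of 4], of "norm z"]
      by (simp add: E_def[abs_def])
  qed
  then have "((\<lambda>w. g a z + cscale (w - a) (E w z + D z)) \<longlongrightarrow> g a z + cscale (a - a) (0 + D z)) (at a within S)"
    by (intro tendsto_intros tendsto_cscale)
  moreover have "\<forall>\<^sub>F w in at a within S. g a z + cscale (w - a) (E w z + D z) = g w z"
    by (auto simp: eventually_at E_def intro!: exI[of _ 1])
  ultimately show ?thesis by (simp add: tendsto_cong)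
qed

text \<open>\<open>P\<close> is the value of \<open>g\<close> at the pole. Letting l decrease to r
  in (l - T)(l - r)R(l)z = (l - r)z shows that \<open>P z\<close> lies in the kernel, and on the
  kernel (l - r)R(l) is already the identity.\<close>

lemma simple_pole_projection:
  assumes T: "bounded_cop T" and pole: "resolvent_pole_order T (complex_of_real r) 1"
  obtains P l where "bounded_cop P" "\<And>n. l n > r" "\<And>n. complex_of_real (l n) \<notin> cspec T"
    "\<And>z. (\<lambda>n. (l n - r) *\<^sub>R resolv T (complex_of_real (l n)) z) \<longlonglongrightarrow> P z"
    "\<And>z. P z \<in> ckernel T r" "\<And>z. z \<in> ckernel T r \<Longrightarrow> P z = z"
proof -
  let ?r = "complex_of_real r"
  obtain e g where e: "e > 0" and g: "\<And>l. l \<in> ball ?r e \<Longrightarrow> bounded_cop (g l)"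
    and hol: "op_holomorphic_on g (ball ?r e)"
    and res: "\<And>l. l \<in> ball ?r e - {?r} \<Longrightarrow> l \<notin> cspec T"
      "\<And>l. l \<in> ball ?r e - {?r} \<Longrightarrow> resolv T l = (\<lambda>z. cscale (1 / (l - ?r)) (g l z))"
    using pole unfolding resolvent_pole_order_def power_one_right by blast
  define l where "l n = r + e / 2 * inverse (real (Suc n))" for n
  have l: "l n > r" for n using e by (simp add: l_def)
  have lb: "complex_of_real (l n) \<in> ball ?r e - {?r}" for n
  proof -
    have "e / 2 * inverse (real (Suc n)) \<le> e / 2 * 1"
      using e by (intro mult_left_mono) (auto simp: field_simps)
    then have "\<bar>r - l n\<bar> < e" using e l[of n] by (simp add: l_def)
    then show ?thesis using l[of n] by (simp add: dist_norm flip: of_real_diff)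
  qed
  have "l \<longlonglongrightarrow> r + e / 2 * 0"
    unfolding l_def by (intro tendsto_intros LIMSEQ_inverse_real_of_nat)
  then have l_lim: "l \<longlonglongrightarrow> r" by simp
  have lim: "filterlim (\<lambda>n. complex_of_real (l n)) (at ?r within ball ?r e) sequentially"
    unfolding filterlim_at using lb tendsto_of_real[OF l_lim] by auto
  have g_eq: "g (of_real (l n)) z = (l n - r) *\<^sub>R resolv T (of_real (l n)) z" for n z
    using res(2)[OF lb[of n]] l[of n]
    by (simp flip: of_real_diff cscale_of_real)
  have P_lim: "(\<lambda>n. (l n - r) *\<^sub>R resolv T (of_real (l n)) z) \<longlonglongrightarrow> g ?r z" for z
    using filterlim_compose[OF op_holomorphic_continuous[OF hol _ g] lim, of z] e by (simp add: g_eq)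
  have T': "bounded_linear T" using T by (simp add: bounded_cop_iff)
  show thesis
  proof
    show "bounded_cop (g ?r)" using g e by simp
    fix z
    have "(\<lambda>n. l n *\<^sub>R ((l n - r) *\<^sub>R resolv T (of_real (l n)) z) - T ((l n - r) *\<^sub>R resolv T (of_real (l n)) z))
        \<longlonglongrightarrow> r *\<^sub>R g ?r z - T (g ?r z)"
      by (intro tendsto_intros l_lim P_lim bounded_linear.tendsto[OF T'])
    moreover have "l n *\<^sub>R ((l n - r) *\<^sub>R resolv T (of_real (l n)) z) - T ((l n - r) *\<^sub>R resolv T (of_real (l n)) z)
        = (l n - r) *\<^sub>R z" for n
    proof -
      have "l n *\<^sub>R resolv T (of_real (l n)) z - T (resolv T (of_real (l n)) z) = z"
        using resolv_right[OF res(1)[OF lb[of n]], of z] by simp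
      from arg_cong[OF this, of "scaleR (l n - r)"] show ?thesis
        by (simp add: linear_simps[OF T'] scaleR_diff_right mult.commute)
    qed
    moreover have "(\<lambda>n. (l n - r) *\<^sub>R z) \<longlonglongrightarrow> (r - r) *\<^sub>R z" by (intro tendsto_intros l_lim)
    ultimately have "r *\<^sub>R g ?r z - T (g ?r z) = (r - r) *\<^sub>R z"
      by (intro LIMSEQ_unique[of "\<lambda>n. (l n - r) *\<^sub>R z"]) simp_all
    then show "g ?r z \<in> ckernel T r" by (simp add: ckernel_def)
    assume z: "z \<in> ckernel T r"
    have "(l n - r) *\<^sub>R resolv T (of_real (l n)) z = z" for n
    proof -
      have "cscale (of_real (l n)) z - T z = (l n - r) *\<^sub>R z"
        using z by (simp add: ckernel_def algebra_simps)
      then show ?thesis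
        using resolv_left[OF res(1)[OF lb[of n]], of z]
          bounded_cop_resolv[OF res(1)[OF lb[of n]]] by (simp add: bounded_cop_iff linear_simps)
    qed
    then have "(\<lambda>n. z) \<longlonglongrightarrow> g ?r z" using P_lim[of z] by simp
    then show "g ?r z = z" using LIMSEQ_unique tendsto_const by blast
  qed (use l lb res P_lim in auto)
qed

lemma funpow_ckernel:
  assumes "bounded_cop T" "z \<in> ckernel T l"
  shows "(T ^^ n) z = cscale (l ^ n) z"
proof (induction n)
  case (Suc n)
  have "(T ^^ Suc n) z = T (cscale (l ^ n) z)" using Suc by simp
  also have "\<dots> = cscale (l ^ n) (T z)" using assms(1) by (simp only: bounded_cop_def)
  also have "T z = cscale l z" using assms(2) by (simp add: ckernel_def)
  finally show ?case by (simp add: mult.commute)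
qed simp

text \<open>Real vectors are differences of positive ones, so they are mapped to real vectors;
  complex linearity then makes both components transform by the same real map.\<close>

lemma positive_cop_real:
  fixes S :: "'r::banach_lattice cop"
  assumes S: "bounded_cop S" "positive_cop S"
  shows "snd (S (x, 0)) = 0" and "0 \<le> x \<Longrightarrow> 0 \<le> fst (S (x, 0))"
    and "S (x, y) = (fst (S (x, 0)), fst (S (y, 0)))"
proof -
  have lin: "bounded_linear S" using S(1) by (simp add: bounded_cop_iff)
  have pos: "S (x, 0) \<in> cpos" if "0 \<le> x" for x
    using S(2) that by (force simp: positive_cop_def cpos_def)
  have snd0: "snd (S (x, 0)) = 0" for x
  proof -
    have "(x, 0) = ((pprt x, 0) - (pprt (- x), 0) :: 'r cvec)" using prts[of x] by (simp add: pprt_neg)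
    then have "S (x, 0) = S (pprt x, 0) - S (pprt (- x), 0)" by (simp only: linear_simps[OF lin])
    then show ?thesis using pos[of "pprt x"] pos[of "pprt (- x)"] by (simp add: cpos_iff)
  qed
  then show "snd (S (x, 0)) = 0" .
  show "0 \<le> x \<Longrightarrow> 0 \<le> fst (S (x, 0))" using pos by (simp add: cpos_iff)
  have "(x, y) = (x, 0) + cscale \<i> (y, 0)" by (simp add: cscale_def)
  then have "S (x, y) = S (x, 0) + cscale \<i> (S (y, 0))"
    using S(1) by (metis bounded_cop_def)
  then show "S (x, y) = (fst (S (x, 0)), fst (S (y, 0)))"
    using snd0[of x] snd0[of y] by (simp add: cscale_def prod_eq_iff)
qed

text \<open>The operator commutes with \<open>rotated\<close> and is monotone on real vectors, so
  the image of \<open>cabs z\<close> is an upper bound of all rotations of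
  \<open>S z\<close>.\<close>

lemma positive_cop_dominates:
  assumes S: "bounded_cop S" "positive_cop S"
  shows "S (cabs z, 0) - (cabs (S z), 0) \<in> cpos"
proof -
  define s where "s x = fst (S (x, 0))" for x
  have lin: "bounded_linear S" using S(1) by (simp add: bounded_cop_iff)
  have s_add: "s (x + y) = s x + s y" and s_scale: "s (t *\<^sub>R x) = t *\<^sub>R s x" for x y t
    using linear_simps(1)[OF lin, of "(x, 0)" "(y, 0)"] linear_simps(5)[OF lin, of t "(x, 0)"]
    by (simp_all add: s_def)
  have mono: "s x \<le> s y" if "x \<le> y" for x y
  proof -
    have "0 \<le> s (y - x)" using positive_cop_real(2)[OF S, of "y - x"] that by (simp add: s_def)
    then show ?thesis using s_add[of "y - x" x] by simp
  qed
  have "cabs (S z) \<le> s (cabs z)"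
  proof (rule cabs_least)
    fix t
    have "rotated (S z) t = s (rotated z t)"
      using positive_cop_real(3)[OF S, of "fst z" "snd z"]
      by (simp add: rotated_def s_add s_scale flip: s_def)
    also have "\<dots> \<le> s (cabs z)" by (intro mono rotated_le_cabs)
    finally show "rotated (S z) t \<le> s (cabs z)" .
  qed
  then show ?thesis using positive_cop_real(1)[OF S] by (simp add: cpos_iff s_def)
qed

lemma peripheral_projection:
  fixes T :: "'r::banach_lattice cop"
  assumes T: "bounded_cop T" and ev: "unif_ev_pos T" and r0: "spr T > 0"
    and pole: "resolvent_pole_order T (complex_of_real (spr T)) 1"
  obtains P where "bounded_cop P" "positive_cop P"
    "\<And>z. P z \<in> ckernel T (spr T)" "\<And>z. z \<in> ckernel T (spr T) \<Longrightarrow> P z = z"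
    "\<And>\<mu> z. cmod \<mu> = spr T \<Longrightarrow> z \<in> ckernel T \<mu> \<Longrightarrow> P (cabs z, 0) - (cabs z, 0) \<in> cpos"
proof -
  define r where "r = spr T"
  obtain P l where P: "bounded_cop P" and l: "\<And>n. l n > r"
    and "\<And>n. complex_of_real (l n) \<notin> cspec T"
    and lim: "\<And>z. (\<lambda>n. (l n - r) *\<^sub>R resolv T (complex_of_real (l n)) z) \<longlonglongrightarrow> P z"
    and ran: "\<And>z. P z \<in> ckernel T r" and fix_ker: "\<And>z. z \<in> ckernel T r \<Longrightarrow> P z = z"
    by (rule simple_pole_projection[OF T pole[folded r_def]]) (rule that)
  obtain n0 where n0: "\<And>n. n \<ge> n0 \<Longrightarrow> positive_cop (T ^^ n)"
    using ev by (auto simp: unif_ev_pos_def)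
  have bT: "bounded_cop (T ^^ n)" for n
  proof -
    have "T (cscale c z) = cscale c (T z)" for c z using T by (simp only: bounded_cop_def)
    then have "(T ^^ n) (cscale c z) = cscale c ((T ^^ n) z)" for c z
      by (induction n) simp_all
    then show ?thesis using T bounded_linear_funpow unfolding bounded_cop_iff by blast
  qed
  have G: "bounded_linear (T ^^ n0)" using bT by (simp add: bounded_cop_iff)
  have res: "complex_of_real m \<notin> cspec T" if "m > r" for m
    using le_spr[OF T, of "of_real m"] that r0 by (auto simp: r_def)
  \<comment> \<open>The resolvent estimate with k = 1, multiplied by l - r, survives the limit;
    there \<open>T ^^ n0\<close> turns into the scalar \<open>r ^ n0\<close> because
    \<open>P u\<close> lies in the kernel.\<close>
  have dom: "r ^ n0 *\<^sub>R P u - v \<in> cpos"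
    if d: "\<And>n. (T ^^ n0) ((T ^^ n) u) - r ^ n *\<^sub>R v \<in> cpos" for u v
  proof -
    have "(l n - r) *\<^sub>R ((T ^^ n0) (resolv T (of_real (l n)) u) - (1 / (l n - r)) *\<^sub>R v) \<in> cpos" for n
      using resolvent_domination[OF T _ res d l[of n], of 1] r0 l[of n]
      by (intro cpos_scaleR) (auto simp: r_def)
    moreover have "(l n - r) *\<^sub>R ((T ^^ n0) (resolv T (of_real (l n)) u) - (1 / (l n - r)) *\<^sub>R v)
        = (T ^^ n0) ((l n - r) *\<^sub>R resolv T (of_real (l n)) u) - v" for n
      using l[of n] by (simp add: scaleR_diff_right linear_simps[OF G])
    ultimately have mem: "(T ^^ n0) ((l n - r) *\<^sub>R resolv T (of_real (l n)) u) - v \<in> cpos" for n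
      by simp
    have "(\<lambda>n. (T ^^ n0) ((l n - r) *\<^sub>R resolv T (of_real (l n)) u) - v) \<longlonglongrightarrow> (T ^^ n0) (P u) - v"
      by (intro tendsto_intros bounded_linear.tendsto[OF G] lim)
    from closed_sequentially[OF closed_cpos mem this] have "(T ^^ n0) (P u) - v \<in> cpos" .
    moreover have "(T ^^ n0) (P u) = r ^ n0 *\<^sub>R P u"
      using funpow_ckernel[OF T ran, of n0 u] by (simp flip: of_real_power)
    ultimately show ?thesis by simp
  qed
  have scale: "P u - v \<in> cpos" if "r ^ n0 *\<^sub>R P u - r ^ n0 *\<^sub>R v \<in> cpos" for u v
    using cpos_scaleR[OF that, of "1 / r ^ n0"] r0 by (simp add: r_def scaleR_diff_right)
  have pos: "positive_cop P"
    unfolding positive_cop_def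
  proof (rule image_subsetI)
    fix u :: "'r cvec" assume u: "u \<in> cpos"
    have "(T ^^ (n0 + n)) u \<in> cpos" for n
      using n0[of "n0 + n"] u by (auto simp: positive_cop_def)
    then have "r ^ n0 *\<^sub>R P u - 0 \<in> cpos" by (intro dom) (simp add: funpow_add)
    then show "P u \<in> cpos" using scale[of u 0] by simp
  qed
  \<comment> \<open>Here v = r^n0 |z|: positivity of \<open>T ^^ (n0 + n)\<close> gives r^(n0 + n)
    |z| = |T^(n0 + n) z| <= T^(n0 + n) |z|. Positivity of \<open>P\<close> was the case v =
    0.\<close>
  have per: "P (cabs z, 0) - (cabs z, 0) \<in> cpos" if \<mu>: "cmod \<mu> = spr T" and z: "z \<in> ckernel T \<mu>" for \<mu> z
  proof -
    have "(T ^^ n0) ((T ^^ n) (cabs z, 0)) - r ^ n *\<^sub>R (r ^ n0 *\<^sub>R (cabs z, 0)) \<in> cpos" for n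
    proof -
      have "cabs ((T ^^ (n0 + n)) z) = r ^ (n0 + n) *\<^sub>R cabs z"
        using \<mu> unfolding funpow_ckernel[OF T z] by (simp add: cabs_cscale norm_power r_def)
      then show ?thesis
        using positive_cop_dominates[OF bT n0[of "n0 + n"], of z]
        by (simp add: funpow_add power_add mult.commute)
    qed
    from scale[OF dom[OF this]] show ?thesis .
  qed
  show thesis using P pos ran fix_ker per unfolding r_def by (rule that)
qed

section \<open>Positive projections with finite-dimensional range\<close>

text \<open>The range of \<open>p\<close> is a vector lattice with infimum
  \<open>p (inf x y)\<close>, though it need not be a sublattice. Hence disjointness always takes
  the form that \<open>p\<close> annihilates an infimum.\<close>

locale positive_projection =
  fixes p :: "'r::banach_lattice \<Rightarrow> 'r"
  assumes lin: "linear p" and pos: "0 \<le> x \<Longrightarrow> 0 \<le> p x" and idem [simp]: "p (p x) = p x"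
begin

lemma p_simps [simp]:
  "p 0 = 0" "p (x + y) = p x + p y" "p (x - y) = p x - p y" "p (t *\<^sub>R x) = t *\<^sub>R p x"
  using lin by (simp_all add: linear_0 linear_add linear_diff linear_scale)

lemma p_mono: "x \<le> y \<Longrightarrow> p x \<le> p y"
  using pos[of "y - x"] by simp

lemma p_eq_0_mono: "0 \<le> x \<Longrightarrow> x \<le> y \<Longrightarrow> p y = 0 \<Longrightarrow> p x = 0"
  using pos[of x] p_mono[of x y] by simp

text \<open>The vectors disjoint from \<open>e\<close> up to the null ideal of \<open>p\<close>.\<close>

definition null :: "'r \<Rightarrow> 'r set" where
  "null e = {x. p (inf (modulus x) e) = 0}"

lemma null_mono:
  assumes "0 \<le> e" "y \<in> null e" "modulus x \<le> modulus y"
  shows "x \<in> null e"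
  using p_eq_0_mono[of "inf (modulus x) e" "inf (modulus y) e"] assms
  by (simp add: null_def le_infI1)

lemma null_modulus: "modulus x \<in> null e \<longleftrightarrow> x \<in> null e"
  by (simp add: null_def)

lemma null_pos_mono: "0 \<le> e \<Longrightarrow> y \<in> null e \<Longrightarrow> 0 \<le> x \<Longrightarrow> x \<le> y \<Longrightarrow> x \<in> null e"
  by (rule null_mono[of e y]) (auto intro: order_trans)

lemma null_0: "0 \<le> e \<Longrightarrow> 0 \<in> null e"
  by (simp add: null_def inf_absorb1)

lemma null_p_eq_0: "0 \<le> e \<Longrightarrow> 0 \<le> x \<Longrightarrow> p x = 0 \<Longrightarrow> x \<in> null e"
  using p_eq_0_mono[of "inf x e" x] by (simp add: null_def)

lemma null_add:
  assumes e: "0 \<le> e" and x: "x \<in> null e" and y: "y \<in> null e"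
  shows "x + y \<in> null e"
proof -
  have "inf (modulus (x + y)) e \<le> inf (modulus x + modulus y) e"
    by (intro inf_mono modulus_triangle order_refl)
  also have "\<dots> \<le> inf (modulus x) e + inf (modulus y) e" using e by (intro inf_add_le) auto
  finally have "p (inf (modulus (x + y)) e) = 0"
    using x y e by - (rule p_eq_0_mono[of _ "inf (modulus x) e + inf (modulus y) e"], auto simp: null_def)
  then show ?thesis by (simp add: null_def)
qed

lemma null_scaleR:
  assumes e: "0 \<le> e" and x: "x \<in> null e"
  shows "t *\<^sub>R x \<in> null e"
proof -
  \<comment> \<open>Dividing by \<open>s\<close> compensates the factor \<open>t\<close> in the
    first argument of the infimum, and s >= 1 keeps the second one below \<open>e\<close>.\<close>
  define s where "s = max 1 \<bar>t\<bar>"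
  have s: "s > 0" "\<bar>t\<bar> \<le> s" "1 \<le> s" by (auto simp: s_def)
  let ?y = "inf (modulus (t *\<^sub>R x)) e"
  have "(1 / s) *\<^sub>R ?y \<le> modulus x"
  proof -
    have "?y \<le> \<bar>t\<bar> *\<^sub>R modulus x" using modulus_scaleR_le le_infI1 by blast
    also have "\<dots> \<le> s *\<^sub>R modulus x" using s by (intro scaleR_right_mono) auto
    finally show ?thesis using s scaleR_left_mono[of ?y "s *\<^sub>R modulus x" "1 / s"] by simp
  qed
  moreover have "(1 / s) *\<^sub>R ?y \<le> e"
  proof -
    have "(1 / s) *\<^sub>R ?y \<le> 1 *\<^sub>R ?y" using s e by (intro scaleR_right_mono) auto
    also have "\<dots> \<le> e" by simp
    finally show ?thesis .
  qed
  ultimately have "p ((1 / s) *\<^sub>R ?y) = 0"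
    using x s e by - (rule p_eq_0_mono[of _ "inf (modulus x) e"], auto simp: null_def scaleR_nonneg_nonneg)
  then show ?thesis using s by (simp add: null_def)
qed

lemma null_uminus: "x \<in> null e \<Longrightarrow> - x \<in> null e"
  by (simp add: null_def)

lemma null_diff: "0 \<le> e \<Longrightarrow> x \<in> null e \<Longrightarrow> y \<in> null e \<Longrightarrow> x - y \<in> null e"
  using null_add[of e x "- y"] null_uminus by simp

lemma null_sum: "0 \<le> e \<Longrightarrow> (\<And>i. i \<in> I \<Longrightarrow> f i \<in> null e) \<Longrightarrow> sum f I \<in> null e"
  by (induction I rule: infinite_finite_induct) (auto intro: null_add null_0)

text \<open>Coefficients at \<open>e\<close> are well defined modulo \<open>null e\<close>:
  otherwise a null vector would dominate a positive multiple of \<open>e\<close>, but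
  \<open>e\<close> is not in \<open>null e\<close>, since p (inf e e) = e.\<close>

lemma coeff_le:
  assumes e: "0 \<le> e" "p e = e" "e \<noteq> 0" and q: "q \<in> null e" and le: "t *\<^sub>R e \<le> s *\<^sub>R e + q"
  shows "t \<le> s"
proof (rule ccontr)
  assume "\<not> t \<le> s"
  then have ts: "t - s > 0" by simp
  have "(t - s) *\<^sub>R e \<le> q" using le by (simp add: scaleR_diff_left algebra_simps)
  then have "(1 / (t - s)) *\<^sub>R (t - s) *\<^sub>R e \<le> (1 / (t - s)) *\<^sub>R q"
    using ts by (intro scaleR_left_mono) auto
  then have "e \<le> (1 / (t - s)) *\<^sub>R q" using ts by simp
  then have "e \<le> modulus ((1 / (t - s)) *\<^sub>R q)" using le_modulus(1) order_trans by blast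
  then have "e \<in> null e"
    using e null_scaleR[OF e(1) q, of "1 / (t - s)"]
    by - (rule null_pos_mono[of e "modulus ((1 / (t - s)) *\<^sub>R q)"], auto simp: null_modulus)
  then show False using e by (simp add: null_def)
qed

definition disjoint_system :: "'r set \<Rightarrow> bool" where
  "disjoint_system B \<longleftrightarrow> finite B \<and> (\<forall>e\<in>B. 0 \<le> e \<and> e \<noteq> 0 \<and> p e = e) \<and>
     (\<forall>e\<in>B. \<forall>f\<in>B. e \<noteq> f \<longrightarrow> p (inf e f) = 0)"

text \<open>All members other than \<open>e\<close> lie in the complex subspace
  \<open>null e \<times> null e\<close>, and \<open>e\<close> does not. This is what bounds the
  number of atoms by the dimension of the kernel.\<close>

lemma disjoint_system_independent:
  assumes B: "disjoint_system B"
  shows "cvec.independent ((\<lambda>e. (e, 0)) ` B)"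
proof
  assume "cvec.dependent ((\<lambda>e. (e, 0)) ` B)"
  then obtain e where e: "e \<in> B" "(e, 0) \<in> cvec.span ((\<lambda>e. (e, 0)) ` B - {(e, 0)})"
    unfolding cvec.dependent_def by auto
  have e': "0 \<le> e" "e \<noteq> 0" "p e = e" using B e(1) by (auto simp: disjoint_system_def)
  have "cvec.subspace (null e \<times> null e)"
    unfolding cvec.subspace_def
    by (auto simp: cscale_def zero_prod_def null_0 null_add null_diff null_scaleR e')
  moreover have "(\<lambda>e. (e, 0)) ` B - {(e, 0)} \<subseteq> null e \<times> null e"
  proof
    fix z :: "'r cvec" assume "z \<in> (\<lambda>e. (e, 0)) ` B - {(e, 0)}"
    then obtain f where f: "f \<in> B" "f \<noteq> e" "z = (f, 0)" by auto
    then have "0 \<le> f" "p (inf f e) = 0" using B e(1) by (auto simp: disjoint_system_def)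
    then show "z \<in> null e \<times> null e" using f e' null_0[of e] by (simp add: null_def)
  qed
  ultimately have "(e, 0) \<in> null e \<times> null e" using e(2) cvec.span_minimal by blast
  then show False using e' by (simp add: null_def)
qed

text \<open>Otherwise \<open>u\<close> could be added to \<open>B\<close>.\<close>

lemma maximal_disjoint_system_total:
  assumes B: "disjoint_system B" and max: "\<And>C. disjoint_system C \<Longrightarrow> card C \<le> card B"
    and u: "0 \<le> u" "p u = u" and null: "\<And>e. e \<in> B \<Longrightarrow> u \<in> null e"
  shows "u = 0"
proof (rule ccontr)
  assume "u \<noteq> 0"
  have inf0: "p (inf u e) = 0" if "e \<in> B" for e using null[OF that] u by (simp add: null_def)
  then have "u \<notin> B" using u \<open>u \<noteq> 0\<close> by force
  moreover have "disjoint_system (insert u B)"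
    using B u \<open>u \<noteq> 0\<close> inf0 by (auto simp: disjoint_system_def inf.commute)
  ultimately show False using max[of "insert u B"] B by (simp add: disjoint_system_def)
qed

text \<open>This is the atom property: if both parts of \<open>w\<close> were visible at
  \<open>e\<close>, they would cut out of \<open>e\<close> two disjoint nonzero fixed vectors, and
  exchanging \<open>e\<close> for them would enlarge \<open>B\<close>.\<close>

lemma maximal_disjoint_system_split:
  assumes B: "disjoint_system B" and max: "\<And>C. disjoint_system C \<Longrightarrow> card C \<le> card B"
    and e: "e \<in> B" and w: "p w = w"
  shows "pprt w \<in> null e \<or> pprt (- w) \<in> null e"
proof (rule ccontr)
  assume contra: "\<not> ?thesis"
  have e': "0 \<le> e" "p e = e" "e \<noteq> 0" using B e by (auto simp: disjoint_system_def)
  define a b where "a = p (inf (pprt w) e)" and "b = p (inf (pprt (- w)) e)"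
  have ab: "a \<noteq> 0" "b \<noteq> 0" using contra by (auto simp: a_def b_def null_def)
  have ab0: "0 \<le> a" "0 \<le> b" using e' by (auto simp: a_def b_def intro!: pos)
  have ab_fix: "p a = a" "p b = b" by (auto simp: a_def b_def)
  have abe: "a \<le> e" "b \<le> e" using p_mono[of "inf (pprt w) e" e] p_mono[of "inf (pprt (- w)) e" e] e'
    unfolding a_def b_def by simp_all
  \<comment> \<open>Since p w = w, the projection moves both parts of \<open>w\<close> by the same
    vector \<open>n\<close>. So inf a b <= n + inf (w+) (w-) = n, and \<open>p\<close> annihilates
    \<open>n\<close>.\<close>
  define n where "n = p (pprt w) - pprt w"
  have w_eq: "w = pprt w - pprt (- w)" using prts[of w] by (simp add: pprt_neg)
  have "p (pprt w - pprt (- w)) = pprt w - pprt (- w)"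
    unfolding w_eq[symmetric] by (rule w)
  then have n2: "n = p (pprt (- w)) - pprt (- w)" by (simp add: n_def algebra_simps)
  have pn: "p n = 0" by (simp add: n_def)
  have disj: "inf (pprt w) (pprt (- w)) = 0"
  proof -
    have "pprt w = - nprt w + w"
      using prts[of w] by (metis add.commute add_diff_cancel_right' diff_conv_add_uminus)
    then have "inf (pprt w) (pprt (- w)) = - nprt w + inf w 0"
      unfolding add_inf_distrib_left by (simp add: pprt_neg)
    then show ?thesis by (simp flip: nprt_def)
  qed
  have "inf a b \<le> inf (pprt w + n) (pprt (- w) + n)"
  proof (rule inf_mono)
    show "a \<le> pprt w + n" using p_mono[of "inf (pprt w) e" "pprt w"] by (simp add: a_def n_def)
    show "b \<le> pprt (- w) + n" using p_mono[of "inf (pprt (- w)) e" "pprt (- w)"] by (simp add: b_def n2)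
  qed
  also have "\<dots> = n" using disj by (simp flip: add_inf_distrib_right)
  finally have iab: "p (inf a b) = 0" using pn ab0 by - (rule p_eq_0_mono[of "inf a b" n], auto)
  then have "a \<noteq> b" using ab ab_fix by auto
  have small: "p (inf c f) = 0" if "0 \<le> c" "c \<le> e" "f \<in> B - {e}" for c f
  proof -
    have "0 \<le> f" "p (inf e f) = 0" using B e that by (auto simp: disjoint_system_def)
    then show ?thesis using that by - (rule p_eq_0_mono[of "inf c f" "inf e f"], auto simp: le_infI1)
  qed
  have notin: "c \<notin> B - {e}" if "0 \<le> c" "c \<le> e" "c \<noteq> 0" "p c = c" for c
    using small[of c c] that by auto
  have "disjoint_system (insert a (insert b (B - {e})))"
    using B ab ab0 ab_fix iab small[OF ab0(1) abe(1)] small[OF ab0(2) abe(2)]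
    by (auto simp: disjoint_system_def inf.commute)
  then have "card (insert a (insert b (B - {e}))) \<le> card B" by (rule max)
  moreover have "card (insert a (insert b (B - {e}))) = Suc (card B)"
  proof -
    have "finite B" using B by (simp add: disjoint_system_def)
    moreover have "card B > 0" using e \<open>finite B\<close> card_gt_0_iff by blast
    ultimately show ?thesis
      using e \<open>a \<noteq> b\<close> notin[OF ab0(1) abe(1) ab(1) ab_fix(1)] notin[OF ab0(2) abe(2) ab(2) ab_fix(2)]
      by (simp add: card_Diff_singleton)
  qed
  ultimately show False by simp
qed

text \<open>\<open>t\<close> is the largest number with t e <= u. By the atom property, for s > t
  either the positive or the negative part of u - s e is null, and the latter would give s e <=
  u.\<close>

lemma maximal_disjoint_system_coeff:
  assumes B: "disjoint_system B" and max: "\<And>C. disjoint_system C \<Longrightarrow> card C \<le> card B"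
    and e: "e \<in> B" and u: "0 \<le> u" "p u = u"
  obtains t where "0 \<le> t" "u - t *\<^sub>R e \<in> null e"
proof -
  have e': "0 \<le> e" "p e = e" "e \<noteq> 0" using B e by (auto simp: disjoint_system_def)
  define A where "A = {t. 0 \<le> t \<and> t *\<^sub>R e \<le> u}"
  have A0: "0 \<in> A" using u by (simp add: A_def)
  have "t \<le> norm u / norm e" if "t \<in> A" for t
    using norm_mono_pos[of "t *\<^sub>R e" u] that e' by (simp add: A_def scaleR_nonneg_nonneg field_simps)
  then have bdd: "bdd_above A" by (rule bdd_aboveI)
  define t where "t = Sup A"
  have t0: "0 \<le> t" unfolding t_def using A0 bdd by (rule cSup_upper)
  have above: "pprt (u - s *\<^sub>R e) \<in> null e" if "s > t" for s
  proof (rule ccontr)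
    assume "pprt (u - s *\<^sub>R e) \<notin> null e"
    then have "pprt (- (u - s *\<^sub>R e)) \<in> null e"
      using maximal_disjoint_system_split[OF B max e, of "u - s *\<^sub>R e"] u e' by simp
    then have nul: "pprt (s *\<^sub>R e - u) \<in> null e" by simp
    have s: "s > 0" using that t0 by simp
    have "pprt (s *\<^sub>R e - u) \<le> s *\<^sub>R e"
      using u(1) s e' by (simp add: pprt_def scaleR_nonneg_nonneg)
    \<comment> \<open>Scaled below \<open>e\<close>, the vector equals its infimum with
      \<open>e\<close>, so membership in \<open>null e\<close> means that \<open>p\<close>
      annihilates it.\<close>
    then have "(1 / s) *\<^sub>R pprt (s *\<^sub>R e - u) \<le> (1 / s) *\<^sub>R s *\<^sub>R e" using s by (intro scaleR_left_mono) auto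
    then have "(1 / s) *\<^sub>R pprt (s *\<^sub>R e - u) \<le> e" using s by simp
    moreover have "(1 / s) *\<^sub>R pprt (s *\<^sub>R e - u) \<in> null e" using nul e' by (intro null_scaleR)
    ultimately have "p ((1 / s) *\<^sub>R pprt (s *\<^sub>R e - u)) = 0"
      using s by (simp add: null_def scaleR_nonneg_nonneg inf_absorb1)
    then have "p (pprt (s *\<^sub>R e - u)) = 0" using s by simp
    moreover have "s *\<^sub>R e - u \<le> pprt (s *\<^sub>R e - u)" by (simp add: pprt_def)
    ultimately have "s *\<^sub>R e - u \<le> 0" using p_mono[of "s *\<^sub>R e - u" "pprt (s *\<^sub>R e - u)"] u e' by simp
    then have "s \<in> A" using s by (simp add: A_def)
    then show False using cSup_upper[OF _ bdd, of s] that by (simp add: t_def)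
  qed
  have te: "t *\<^sub>R e \<le> u"
  proof -
    have "t *\<^sub>R e - u \<le> \<delta> *\<^sub>R e" if \<delta>: "\<delta> > 0" for \<delta>
    proof -
      obtain s where s: "s \<in> A" "t - \<delta> < s"
        using less_cSupD[of A "t - \<delta>"] A0 \<delta> unfolding t_def by fastforce
      have "(t - \<delta>) *\<^sub>R e \<le> s *\<^sub>R e" using s e' by (intro scaleR_right_mono) auto
      also have "\<dots> \<le> u" using s by (simp add: A_def)
      finally show ?thesis by (simp add: algebra_simps)
    qed
    then have "t *\<^sub>R e - u \<le> 0" by (rule archimedean)
    then show ?thesis by simp
  qed
  have "p (inf (u - t *\<^sub>R e) e) \<le> \<delta> *\<^sub>R e" if \<delta>: "\<delta> > 0" for \<delta>
  proof -
    let ?q = "pprt (u - (t + \<delta>) *\<^sub>R e)"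
    have \<delta>e: "0 \<le> \<delta> *\<^sub>R e" using \<delta> e' by (simp add: scaleR_nonneg_nonneg)
    have "u - (t + \<delta>) *\<^sub>R e \<le> ?q" by (simp add: pprt_def)
    then have "u - t *\<^sub>R e \<le> ?q + \<delta> *\<^sub>R e" by (simp add: algebra_simps)
    then have "inf (u - t *\<^sub>R e) e \<le> inf (?q + \<delta> *\<^sub>R e) e" by (intro inf_mono) auto
    also have "\<dots> \<le> inf ?q e + inf (\<delta> *\<^sub>R e) e" using \<delta>e e' by (intro inf_add_le) auto
    also have "\<dots> \<le> inf ?q e + \<delta> *\<^sub>R e" by (intro add_left_mono) simp
    finally have "p (inf (u - t *\<^sub>R e) e) \<le> p (inf ?q e + \<delta> *\<^sub>R e)" by (rule p_mono)
    also have "\<dots> = \<delta> *\<^sub>R e" using above[of "t + \<delta>"] \<delta> e' by (simp add: null_def)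
    finally show ?thesis .
  qed
  then have "p (inf (u - t *\<^sub>R e) e) \<le> 0" by (rule archimedean)
  moreover have "0 \<le> p (inf (u - t *\<^sub>R e) e)" using te e' by (intro pos) simp
  ultimately have "u - t *\<^sub>R e \<in> null e" using te by (simp add: null_def)
  then show thesis using t0 that by blast
qed

end

section \<open>Peripheral eigenvectors at a single atom\<close>

context positive_projection
begin

text \<open>The vector |z| itself need not be fixed by \<open>p\<close>, but it differs from p |z|
  by a positive vector that \<open>p\<close> annihilates, and such a vector is null at every
  atom.\<close>

lemma peripheral_coeff:
  assumes B: "disjoint_system B" and max: "\<And>C. disjoint_system C \<Longrightarrow> card C \<le> card B"
    and e: "e \<in> B" and z: "cabs z \<le> p (cabs z)"
  obtains s where "0 \<le> s" "cabs z - s *\<^sub>R e \<in> null e"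
proof -
  have e': "0 \<le> e" using B e by (auto simp: disjoint_system_def)
  obtain s where s: "0 \<le> s" "p (cabs z) - s *\<^sub>R e \<in> null e"
    using maximal_disjoint_system_coeff[OF B max e, of "p (cabs z)"] pos[of "cabs z"] by auto
  have "p (cabs z) - cabs z \<in> null e" using z e' by (intro null_p_eq_0) auto
  from null_diff[OF e' s(2) this] have "cabs z - s *\<^sub>R e \<in> null e" by (simp add: algebra_simps)
  then show thesis using s that by blast
qed

text \<open>If \<open>z\<close>, \<open>w\<close> were functions, one would take \<open>(a, b)\<close> with \<open>a z(t) + b w(t) = 0\<close> at a single
  point \<open>t\<close>: the modulus of \<open>a z + b w\<close> being a multiple of \<open>e\<close>, it then vanishes everywhere.
  In place of a point, a grid of possible values of \<open>(z, w)\<close> with mesh \<open>1/n\<close> gives some \<open>(a, b)\<close>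
  on the unit sphere whose multiple is \<open>O(1/n)\<close>; compactness finishes the argument.\<close>

lemma peripheral_pair_dependent_mod_null:
  fixes K :: "'r cvec set"
  assumes B: "disjoint_system B" and max: "\<And>C. disjoint_system C \<Longrightarrow> card C \<le> card B"
    and eB: "e \<in> B" and K: "cvec.subspace K" "\<And>z. z \<in> K \<Longrightarrow> cabs z \<le> p (cabs z)"
    and z: "z \<in> K" and w: "w \<in> K"
  shows "\<exists>a b. (a, b) \<noteq> (0, 0) \<and> cabs (cscale a z + cscale b w) \<in> null e"
proof -
  have e: "0 \<le> e" "p e = e" "e \<noteq> 0" using B eB by (auto simp: disjoint_system_def)
  have "\<forall>v\<in>K. \<exists>s. 0 \<le> s \<and> cabs v - s *\<^sub>R e \<in> null e"
    using peripheral_coeff[OF B max eB] K(2) by metis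
  then obtain s where s0: "\<And>v. v \<in> K \<Longrightarrow> 0 \<le> s v"
    and s: "\<And>v. v \<in> K \<Longrightarrow> cabs v - s v *\<^sub>R e \<in> null e" by metis
  have s_le: "s v \<le> c1 * s v1 + c2 * s v2"
    if "v \<in> K" "v1 \<in> K" "v2 \<in> K" and le: "cabs v \<le> c1 *\<^sub>R cabs v1 + c2 *\<^sub>R cabs v2" for v v1 v2 c1 c2
  proof (rule coeff_le[OF e])
    let ?q = "\<lambda>v. cabs v - s v *\<^sub>R e"
    show "c1 *\<^sub>R ?q v1 + c2 *\<^sub>R ?q v2 - ?q v \<in> null e"
      by (rule null_diff[OF e(1) null_add[OF e(1) null_scaleR[OF e(1) s[OF that(2)]]
              null_scaleR[OF e(1) s[OF that(3)]]] s[OF that(1)]])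
    show "s v *\<^sub>R e \<le> (c1 * s v1 + c2 * s v2) *\<^sub>R e + (c1 *\<^sub>R ?q v1 + c2 *\<^sub>R ?q v2 - ?q v)"
      using le by (simp add: algebra_simps)
  qed
  have comb: "cscale a z + cscale b w \<in> K" for a b
    using K(1) z w by (auto intro: cvec.subspace_add cvec.subspace_scale)
  define F where "F q = s (cscale (fst q) z + cscale (snd q) w)" for q
  define L where "L = s z + s w"
  have L: "0 \<le> L" using s0 z w by (simp add: L_def)
  have proj_le: "cmod (fst q) \<le> norm q" "cmod (snd q) \<le> norm q" for q :: "complex \<times> complex"
    using norm_fst_le[of "fst q" "snd q"] norm_snd_le[of "snd q" "fst q"] by simp_all
  have F_le: "F q \<le> F q' + L * dist q q'" for q q'
  proof -
    have "F (q - q') \<le> cmod (fst (q - q')) * s z + cmod (snd (q - q')) * s w"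
      unfolding F_def
    proof (rule s_le[OF comb z w])
      show "cabs (cscale (fst (q - q')) z + cscale (snd (q - q')) w)
          \<le> cmod (fst (q - q')) *\<^sub>R cabs z + cmod (snd (q - q')) *\<^sub>R cabs w"
        unfolding cabs_cscale[symmetric] by (rule cabs_triangle)
    qed
    also have "\<dots> \<le> norm (q - q') * s z + norm (q - q') * s w"
      by (intro add_mono mult_right_mono proj_le s0 z w)
    finally have 1: "F (q - q') \<le> L * dist q q'" by (simp add: L_def dist_norm algebra_simps)
    have "F q \<le> 1 * F q' + 1 * F (q - q')"
      unfolding F_def
    proof (rule s_le[OF comb comb comb])
      have "cscale (fst q) z + cscale (snd q) w
          = (cscale (fst q') z + cscale (snd q') w) + (cscale (fst (q - q')) z + cscale (snd (q - q')) w)"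
        by (simp add: cvec.scale_left_diff_distrib)
      then show "cabs (cscale (fst q) z + cscale (snd q) w) \<le> 1 *\<^sub>R cabs (cscale (fst q') z + cscale (snd q') w)
          + 1 *\<^sub>R cabs (cscale (fst (q - q')) z + cscale (snd (q - q')) w)"
        using cabs_triangle by simp
    qed
    then show ?thesis using 1 by simp
  qed
  have "L-lipschitz_on (sphere 0 1) F"
  proof (rule lipschitz_onI[OF _ L])
    fix q q' :: "complex \<times> complex"
    show "dist (F q) (F q') \<le> L * dist q q'"
      using F_le[of q q'] F_le[of q' q] by (simp add: dist_real_def dist_commute abs_le_iff)
  qed
  then have "continuous_on (sphere 0 1) F" by (rule lipschitz_on_continuous_on)
  moreover have "compact (sphere (0 :: complex \<times> complex) 1)" by simp
  moreover have "(1, 0) \<in> sphere (0 :: complex \<times> complex) 1" by (simp add: norm_Pair)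
  ultimately obtain q0 where q0: "q0 \<in> sphere 0 1" "\<And>q. q \<in> sphere 0 1 \<Longrightarrow> F q0 \<le> F q"
    using continuous_attains_inf[of "sphere 0 1" F] by blast
  define m where "m = F q0"
  define u where "u = cabs z + cabs w"
  have bounds: "modulus (fst z) \<le> u" "modulus (snd z) \<le> u" "modulus (fst w) \<le> u" "modulus (snd w) \<le> u"
    unfolding u_def
    by (simp_all add: modulus_fst_le_cabs modulus_snd_le_cabs add_increasing add_increasing2)
  have m_le: "m \<le> 4 / real n * L" if n: "n > 0" for n
  proof -
    define A where "A y k = modulus (y - (of_int k / of_nat n) *\<^sub>R u)" for y and k :: int
    define I where "I = {- int n..int n}"
    have kernel: "\<exists>q\<in>sphere 0 1. fst q * c1 + snd q * c2 = 0" for c1 c2 :: complex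
    proof (cases "c1 = 0 \<and> c2 = 0")
      case True
      then show ?thesis using \<open>(1, 0) \<in> sphere 0 1\<close> by (intro bexI[of _ "(1, 0)"]) auto
    next
      case False
      define N where "N = norm (c2, - c1)"
      have "N \<noteq> 0" using False by (auto simp: N_def zero_prod_def)
      then have "norm ((1 / N) *\<^sub>R (c2, - c1)) = 1" by (simp add: N_def del: scaleR_Pair)
      moreover have "fst ((1 / N) *\<^sub>R (c2, - c1)) * c1 + snd ((1 / N) *\<^sub>R (c2, - c1)) * c2 = 0" by simp
      ultimately show ?thesis by (metis mem_sphere_0)
    qed
    define c where "c k k' = Complex (of_int k / of_nat n) (of_int k' / of_nat n)" for k k' :: int
    \<comment> \<open>At a hypothetical point where (z, w) takes the value (c1, c2), the combination
      with coefficients \<open>Q c1 c2\<close> vanishes.\<close>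
    define Q where "Q c1 c2 = (SOME q. q \<in> sphere 0 1 \<and> fst q * c1 + snd q * c2 = 0)" for c1 c2 :: complex
    have Q: "Q c1 c2 \<in> sphere 0 1" "fst (Q c1 c2) * c1 + snd (Q c1 c2) * c2 = 0" for c1 c2
      using kernel[of c1 c2] someI_ex[of "\<lambda>q. q \<in> sphere 0 1 \<and> fst q * c1 + snd q * c2 = 0"]
      unfolding Q_def by blast+
    define v where "v g = (case g of (k1, k2, k3, k4) \<Rightarrow>
      (let q = Q (c k1 k2) (c k3 k4) in cscale (fst q) z + cscale (snd q) w))" for g
    define G where "G = I \<times> I \<times> I \<times> I"
    have vK: "v g \<in> K" for g by (auto simp: v_def Let_def comb split: prod.split)
    have m_v: "m \<le> s (v g)" for g
      using q0(2)[OF Q(1)] by (auto simp: m_def v_def Let_def F_def split: prod.split)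
    \<comment> \<open>The grid is finite, so the null errors at all grid points can be collected in
      a single null vector.\<close>
    define R where "R = (\<Sum>g\<in>G. modulus (cabs (v g) - s (v g) *\<^sub>R e))"
    have R: "R \<in> null e" unfolding R_def using e s vK by (intro null_sum) (auto simp: null_modulus)
    define b where "b = (1 / 4) *\<^sub>R (m *\<^sub>R e - R)"
    have b_le: "b \<le> sup (sup (A (fst z) k1) (A (snd z) k2)) (sup (A (fst w) k3) (A (snd w) k4))"
      (is "_ \<le> ?S") if k: "k1 \<in> I" "k2 \<in> I" "k3 \<in> I" "k4 \<in> I" for k1 k2 k3 k4
    proof -
      let ?g = "(k1, k2, k3, k4)"
      define q where "q = Q (c k1 k2) (c k3 k4)"
      define z' where "z' = z - cscale (c k1 k2) (u, 0)"
      define w' where "w' = w - cscale (c k3 k4) (u, 0)"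
      have q1: "cmod (fst q) \<le> 1" "cmod (snd q) \<le> 1"
        using Q(1)[of "c k1 k2" "c k3 k4"] proj_le[of q] by (simp_all add: q_def)
      \<comment> \<open>Subtracting the grid values, in units of \<open>u\<close>, from
        \<open>z\<close> and \<open>w\<close> does not change the combination, because
        \<open>q\<close> annihilates them. What remains is controlled by four real distances; hence
        the factor 4 in \<open>b\<close>.\<close>
      have v_eq: "v ?g = cscale (fst q) z' + cscale (snd q) w'"
      proof -
        have "cscale (fst q) z' + cscale (snd q) w' = v ?g - cscale (fst q * c k1 k2 + snd q * c k3 k4) (u, 0)"
          by (simp add: v_def z'_def w'_def q_def Let_def cvec.scale_right_diff_distrib cvec.scale_left_distrib)
        then show ?thesis using Q(2)[of "c k1 k2" "c k3 k4"] by (simp add: q_def)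
      qed
      have contr: "cabs (cscale t y) \<le> modulus (fst y) + modulus (snd y)" if "cmod t \<le> 1" for t and y :: "'r cvec"
      proof -
        have "cabs (cscale t y) \<le> 1 *\<^sub>R cabs y"
          unfolding cabs_cscale using that by (intro scaleR_right_mono) auto
        then show ?thesis using cabs_le order_trans by simp blast
      qed
      have "cabs (v ?g) \<le> (modulus (fst z') + modulus (snd z')) + (modulus (fst w') + modulus (snd w'))"
        unfolding v_eq using cabs_triangle add_mono[OF contr[OF q1(1)] contr[OF q1(2)]] by (rule order_trans)
      also have "\<dots> = (A (fst z) k1 + A (snd z) k2) + (A (fst w) k3 + A (snd w) k4)"
        by (simp add: A_def z'_def w'_def c_def cscale_def)
      also have "\<dots> \<le> (?S + ?S) + (?S + ?S)"
        by (intro add_mono) (auto intro: le_supI1 le_supI2)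
      also have "\<dots> = 4 *\<^sub>R ?S" by (simp flip: scaleR_2)
      finally have 1: "cabs (v ?g) \<le> 4 *\<^sub>R ?S" .
      have "modulus (cabs (v ?g) - s (v ?g) *\<^sub>R e) \<le> R"
        unfolding R_def using k
          sum_mono2[of G "{?g}" "\<lambda>g. modulus (cabs (v g) - s (v g) *\<^sub>R e)"]
        by (auto simp: G_def I_def)
      with le_modulus(2) have "- (cabs (v ?g) - s (v ?g) *\<^sub>R e) \<le> R" by (rule order_trans)
      then have "s (v ?g) *\<^sub>R e \<le> cabs (v ?g) + R" by (simp add: algebra_simps)
      with scaleR_right_mono[OF m_v e(1)] have "m *\<^sub>R e \<le> cabs (v ?g) + R" by (rule order_trans)
      then have "m *\<^sub>R e - R \<le> cabs (v ?g)" by (simp add: algebra_simps)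
      with 1 have "m *\<^sub>R e - R \<le> 4 *\<^sub>R ?S" by (rule order_trans[rotated])
      then show ?thesis
        unfolding b_def using scaleR_left_mono[of "m *\<^sub>R e - R" "4 *\<^sub>R ?S" "1/4"] by simp
    qed
    let ?d = "(1 / of_nat n) *\<^sub>R u"
    have I: "k \<in> I" if "\<bar>k\<bar> \<le> int n" for k using that by (auto simp: I_def)
    \<comment> \<open>The four real coordinates are eliminated one at a time, each being replaced by
      u/n.\<close>
    have 4: "b \<le> sup (sup (sup (A (fst z) k1) (A (snd z) k2)) (A (fst w) k3)) ?d"
      if "k1 \<in> I" "k2 \<in> I" "k3 \<in> I" for k1 k2 k3
      using b_le that I by (intro grid_elimination[OF n bounds(4)]) (simp add: A_def sup.assoc)
    have 3: "b \<le> sup (sup (sup (A (fst z) k1) (A (snd z) k2)) ?d) ?d" if "k1 \<in> I" "k2 \<in> I" for k1 k2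
      using 4 that I by (intro grid_elimination[OF n bounds(3)]) (simp add: A_def ac_simps)
    have 2: "b \<le> sup (sup (A (fst z) k1) ?d) ?d" if "k1 \<in> I" for k1
      using 3 that I by (intro grid_elimination[OF n bounds(2)]) (simp add: A_def ac_simps)
    have "b \<le> sup ?d ?d"
      using 2 I by (intro grid_elimination[OF n bounds(1)]) (simp add: A_def ac_simps)
    then have "4 *\<^sub>R b \<le> 4 *\<^sub>R ?d" by (intro scaleR_left_mono) auto
    then have "m *\<^sub>R e - R \<le> (4 / of_nat n) *\<^sub>R u" by (simp add: b_def)
    also have "u = L *\<^sub>R e + ((cabs z - s z *\<^sub>R e) + (cabs w - s w *\<^sub>R e))"
      by (simp add: u_def L_def algebra_simps)
    finally have "m *\<^sub>R e \<le> (4 / of_nat n * L) *\<^sub>R e +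
        ((4 / of_nat n) *\<^sub>R ((cabs z - s z *\<^sub>R e) + (cabs w - s w *\<^sub>R e)) + R)"
      by (simp add: scaleR_add_right algebra_simps)
    then show ?thesis
      by (rule coeff_le[OF e null_add[OF e(1) null_scaleR[OF e(1) null_add[OF e(1) s[OF z] s[OF w]]] R]])
  qed
  have "m \<le> 0"
  proof (rule LIMSEQ_le_const[of "\<lambda>n. 4 * L * inverse (real (Suc n))"])
    show "(\<lambda>n. 4 * L * inverse (real (Suc n))) \<longlonglongrightarrow> 0"
      using tendsto_mult[OF tendsto_const LIMSEQ_inverse_real_of_nat, of "4 * L"] by simp
    show "\<exists>N. \<forall>n\<ge>N. m \<le> 4 * L * inverse (real (Suc n))"
      using m_le[of "Suc _"] by (auto simp: field_simps)
  qed
  moreover have "0 \<le> m" unfolding m_def F_def by (intro s0 comb)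
  ultimately have "m = 0" by simp
  then have "cabs (cscale (fst q0) z + cscale (snd q0) w) \<in> null e"
    using s[OF comb, of "fst q0" "snd q0"] by (simp add: m_def F_def)
  moreover have "(fst q0, snd q0) \<noteq> (0, 0)" using q0(1) by (auto simp: zero_prod_def)
  ultimately show ?thesis by blast
qed

end

text \<open>Pairwise dependence modulo \<open>N e\<close> means that intersecting \<open>V\<close>
  with \<open>N e\<close> lowers the dimension by at most one; after all \<open>e\<close> nothing
  but 0 is left.\<close>

lemma (in vector_space) span_of_pairwise_dependent:
  assumes "finite B" "subspace V" "\<And>e. e \<in> B \<Longrightarrow> subspace (N e)"
    and "\<And>e z w. e \<in> B \<Longrightarrow> z \<in> V \<Longrightarrow> w \<in> V \<Longrightarrow> \<exists>a b. (a, b) \<noteq> (0, 0) \<and> scale a z + scale b w \<in> N e"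
    and "V \<inter> (\<Inter>e\<in>B. N e) \<subseteq> {0}"
  shows "\<exists>C. finite C \<and> card C \<le> card B \<and> V \<subseteq> span C"
  using assms
proof (induction B arbitrary: V rule: finite_induct)
  case empty
  then show ?case by (intro exI[of _ "{}"]) auto
next
  case (insert e B)
  have "\<exists>C. finite C \<and> card C \<le> card B \<and> V \<inter> N e \<subseteq> span C"
    by (rule insert.IH) (use insert.prems in \<open>auto intro!: subspace_inter\<close>)
  then obtain C where C: "finite C" "card C \<le> card B" "V \<inter> N e \<subseteq> span C" by blast
  show ?case
  proof (cases "V \<subseteq> N e")
    case True
    then have "V \<inter> N e = V" by blast
    then show ?thesis using C insert.hyps by (intro exI[of _ C]) auto
  next
    case False
    then obtain v where v: "v \<in> V" "v \<notin> N e" by blast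
    have "z \<in> span (insert v C)" if z: "z \<in> V" for z
    proof -
      obtain a b where ab: "(a, b) \<noteq> (0, 0)" "scale a z + scale b v \<in> N e"
        using insert.prems(3)[of e z v] z v(1) by auto
      have sub: "subspace (N e)" using insert.prems(2) by simp
      have a: "a \<noteq> 0"
      proof
        assume "a = 0"
        then have "b \<noteq> 0" "scale b v \<in> N e" using ab by auto
        then have "scale (1 / b) (scale b v) \<in> N e" using sub subspace_scale by blast
        then show False using \<open>b \<noteq> 0\<close> v(2) by simp
      qed
      have "scale a z + scale b v \<in> V"
        using insert.prems(1) z v(1) by (intro subspace_add subspace_scale)
      then have "scale a z + scale b v \<in> span C" using ab C by blast
      then have "scale a z + scale b v \<in> span (insert v C)" using span_mono[of C "insert v C"] by blast
      moreover have "scale b v \<in> span (insert v C)" by (intro span_scale span_base) simp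
      ultimately have "scale a z + scale b v - scale b v \<in> span (insert v C)" by (rule span_diff)
      from span_scale[OF this, of "1 / a"] show ?thesis using a by simp
    qed
    moreover have "card (insert v C) \<le> card (insert e B)"
      using C insert.hyps by (simp add: card_insert_if)
    ultimately show ?thesis using C(1) by (intro exI[of _ "insert v C"]) auto
  qed
qed

lemma cdim_le_card:
  assumes "V \<subseteq> cvec.span C" "finite C"
  shows "cdim V \<le> enat (card C)"
proof -
  obtain B where B: "B \<subseteq> V" "cvec.independent B" "V \<subseteq> cvec.span B" "card B = cvec.dim V"
    by (rule cvec.basis_exists) (rule that)
  have "finite B"
    using cvec.independent_span_bound[OF assms(2) B(2) subset_trans[OF B(1) assms(1)]] by simp
  with B have "\<exists>B. finite B \<and> B \<subseteq> V \<and> cvec.independent B \<and> V \<subseteq> cvec.span B"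
    by (intro exI[of _ B]) simp
  then have "cdim V = enat (cvec.dim V)" by (simp only: cdim_def if_True)
  then show ?thesis using cvec.dim_le_card[OF assms] by simp
qed

lemma card_le_cdim:
  assumes "S \<subseteq> V" "cvec.independent S"
  shows "enat (card S) \<le> cdim V"
proof (cases "\<exists>B. finite B \<and> B \<subseteq> V \<and> cvec.independent B \<and> V \<subseteq> cvec.span B")
  case True
  then obtain B where B: "finite B" "B \<subseteq> V" "cvec.independent B" "V \<subseteq> cvec.span B" by blast
  have "card S \<le> card B"
    using cvec.independent_span_bound[OF B(1) assms(2)] assms(1) B(4) by blast
  also have "card B = cvec.dim V" using B by (intro cvec.basis_card_eq_dim)
  finally show ?thesis using True by (simp add: cdim_def)
next
  case False
  then show ?thesis by (simp only: cdim_def if_False) simp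
qed

text \<open>If |z| is null at every atom, so is p |z|; being fixed, it vanishes by maximality, and
  |z| <= p |z| gives z = 0. Thus the atoms separate \<open>K\<close>, and each contributes at most
  one dimension.\<close>

lemma (in positive_projection) peripheral_cdim_le:
  assumes K: "cvec.subspace K" "\<And>z. z \<in> K \<Longrightarrow> cabs z \<le> p (cabs z)"
    and d: "\<And>C. disjoint_system C \<Longrightarrow> card C \<le> d"
  shows "cdim K \<le> enat d"
proof -
  have "disjoint_system {}" by (simp add: disjoint_system_def)
  \<comment> \<open>Largest in cardinality, not just maximal for inclusion: the splitting argument
    exchanges one member for two.\<close>
  then obtain B where B: "disjoint_system B" and max: "\<And>C. disjoint_system C \<Longrightarrow> card C \<le> card B"
    using ex_has_greatest_nat[of disjoint_system "{}" card "Suc d"] d by (auto simp: less_Suc_eq_le)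
  have fin: "finite B" and B0: "\<And>e. e \<in> B \<Longrightarrow> 0 \<le> e" using B by (auto simp: disjoint_system_def)
  define N where "N e = {z. cabs z \<in> null e}" for e
  have sub: "cvec.subspace (N e)" if "e \<in> B" for e
  proof (rule cvec.subspaceI)
    have "cabs 0 = (0 :: 'r)" using cabs_cscale[of 0 0] by simp
    then show "0 \<in> N e" using B0[OF that] by (simp add: N_def null_0)
    fix z w assume "z \<in> N e" "w \<in> N e"
    then have "cabs z + cabs w \<in> null e" using B0[OF that] by (simp add: N_def null_add)
    then show "z + w \<in> N e"
      using null_pos_mono[OF B0[OF that] _ cabs_nonneg cabs_triangle] by (simp add: N_def)
  next
    fix c z assume "z \<in> N e"
    then show "cscale c z \<in> N e" using B0[OF that] by (simp add: N_def cabs_cscale null_scaleR)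
  qed
  have pair: "\<exists>a b. (a, b) \<noteq> (0, 0) \<and> cscale a z + cscale b w \<in> N e"
    if "e \<in> B" "z \<in> K" "w \<in> K" for e z w
    using peripheral_pair_dependent_mod_null[OF B max that(1) K that(2,3)] unfolding N_def by simp
  have "K \<inter> (\<Inter>e\<in>B. N e) \<subseteq> {0}"
  proof
    fix z assume z: "z \<in> K \<inter> (\<Inter>e\<in>B. N e)"
    have "p (cabs z) = 0"
    proof (rule maximal_disjoint_system_total[OF B max])
      show "p (cabs z) \<in> null e" if e: "e \<in> B" for e
      proof -
        have "p (cabs z) - cabs z \<in> null e" using K(2) z B0[OF e] by (intro null_p_eq_0) auto
        moreover have "cabs z \<in> null e" using z e by (auto simp: N_def)
        ultimately have "p (cabs z) - cabs z + cabs z \<in> null e" by (rule null_add[OF B0[OF e]])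
        then show ?thesis by simp
      qed
    qed (auto intro: pos)
    then have "cabs z \<le> 0" using K(2)[of z] z by simp
    then show "z \<in> {0}" using cabs_le_0D by blast
  qed
  from cvec.span_of_pairwise_dependent[OF fin K(1) sub pair this]
  obtain C where C: "finite C" "card C \<le> card B" "K \<subseteq> cvec.span C" by blast
  have "cdim K \<le> enat (card C)" using C by (intro cdim_le_card)
  also have "\<dots> \<le> enat (card B)" using C by simp
  also have "\<dots> \<le> enat d" using d[OF B] by simp
  finally show ?thesis .
qed

lemma subspace_ckernel:
  assumes "bounded_cop T"
  shows "cvec.subspace (ckernel T l)"
proof (rule cvec.subspaceI)
  have lin: "bounded_linear T" using assms by (simp add: bounded_cop_iff)
  show "0 \<in> ckernel T l" by (simp add: ckernel_def linear_simps[OF lin])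
  fix z w assume "z \<in> ckernel T l" "w \<in> ckernel T l"
  then show "z + w \<in> ckernel T l"
    by (simp add: ckernel_def linear_simps[OF lin] cvec.scale_right_distrib)
next
  fix c z assume "z \<in> ckernel T l"
  then have "T z = cscale l z" by (simp add: ckernel_def)
  moreover have "T (cscale c z) = cscale c (T z)" using assms by (simp only: bounded_cop_def)
  ultimately show "cscale c z \<in> ckernel T l" by (simp add: ckernel_def mult.commute)
qed

theorem theorem4p4:
  fixes T :: "'r::banach_lattice cop"
  assumes "bounded_cop T"
    and "unif_ev_pos T"
    and "riesz_point T (complex_of_real (spr T))"
    and "resolvent_pole_order T (complex_of_real (spr T)) 1"
  shows "\<forall>l::complex. cmod l = spr T \<longrightarrow>
           cdim (ckernel T l) \<le> cdim (ckernel T (complex_of_real (spr T)))"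
proof (intro allI impI)
  fix l assume l: "cmod l = spr T"
  show "cdim (ckernel T l) \<le> cdim (ckernel T (complex_of_real (spr T)))"
  \<comment> \<open>If the spectral radius is 0, then l = 0 and both kernels coincide.\<close>
  proof (cases "spr T = 0 \<or> cdim (ckernel T (complex_of_real (spr T))) = \<infinity>")
    case True
    then show ?thesis using l by auto
  next
    case False
    then have r: "spr T > 0" using l norm_ge_zero[of l] by linarith
    obtain d where d: "cdim (ckernel T (complex_of_real (spr T))) = enat d" using False by auto
    obtain P where P: "bounded_cop P" "positive_cop P"
      and ran: "\<And>z. P z \<in> ckernel T (complex_of_real (spr T))"
      and ker: "\<And>z. z \<in> ckernel T (complex_of_real (spr T)) \<Longrightarrow> P z = z"
      and per: "\<And>\<mu> z. cmod \<mu> = spr T \<Longrightarrow> z \<in> ckernel T \<mu> \<Longrightarrow> P (cabs z, 0) - (cabs z, 0) \<in> cpos"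
      by (rule peripheral_projection[OF assms(1,2) r assms(4)]) (rule that)
    have lin: "bounded_linear P" using P(1) by (simp add: bounded_cop_iff)
    define p where "p x = fst (P (x, 0))" for x
    have Pp: "P (x, 0) = (p x, 0)" for x
      using positive_cop_real(1)[OF P, of x] by (simp add: p_def prod_eq_iff)
    interpret positive_projection p
    proof
      show "p (x + y) = p x + p y" for x y
        using linear_simps(1)[OF lin, of "(x, 0)" "(y, 0)"] by (simp add: p_def)
      show "p (t *\<^sub>R x) = t *\<^sub>R p x" for t x
        using linear_simps(5)[OF lin, of t "(x, 0)"] by (simp add: p_def)
      show "0 \<le> x \<Longrightarrow> 0 \<le> p x" for x using positive_cop_real(2)[OF P] by (simp add: p_def)
      show "p (p x) = p x" for x using ker[OF ran, of "(x, 0)"] by (simp add: Pp)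
    qed
    have "cdim (ckernel T l) \<le> enat d"
    proof (rule peripheral_cdim_le)
      show "cvec.subspace (ckernel T l)" using assms(1) by (rule subspace_ckernel)
      show "cabs z \<le> p (cabs z)" if "z \<in> ckernel T l" for z
        using per[OF l that] by (simp add: Pp cpos_iff)
      fix C assume C: "disjoint_system C"
      have "(\<lambda>e. (e, 0)) ` C \<subseteq> ckernel T (complex_of_real (spr T))"
      proof (rule image_subsetI)
        fix e assume "e \<in> C"
        then have "p e = e" using C by (simp add: disjoint_system_def)
        then show "(e, 0) \<in> ckernel T (complex_of_real (spr T))" using ran[of "(e, 0)"] by (simp add: Pp)
      qed
      from card_le_cdim[OF this disjoint_system_independent[OF C]] show "card C \<le> d"
        by (simp add: d card_image inj_on_def)
    qed
    then show ?thesis by (simp add: d)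
  qed
qed

end
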